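(* Let $\Sigma_1^m$ and $\Sigma_2^m$ be properly embedded connected self-shrinkers in the Euclidean space $\mathbb{R}^{m+1}$. Assume that, for some real polynomial $P\in\mathbb{R}[t]$ and some constants $b,c>0$ satisfying $0<mc+b<\tfrac12$, the following two conditions hold: $$\liminf_{|z|\to+\infty,\ z\in\Sigma_2}\ \frac{\mathrm{dist}_{\mathbb{R}^{m+1}}(z,\Sigma_1)}{e^{-b|z|^2}P(|z|)^{-1}}>0,$$ and the ray $R(z)>0$ of a regular normal tubular neighborhood $\mathcal{T}(\Sigma_2)$ of $\Sigma_2$ at the point $z\in\Sigma_2$ satisfies $$\liminf_{|z|\to+\infty,\ z\in\Sigma_2}\ \frac{R(z)}{e^{-c|z|^2}P(|z|)^{-1}}>0.$$ Then $\Sigma_1\cap\Sigma_2\neq\emptyset$.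
   Context: A self-shrinker is a hypersurface $x:\Sigma^m\to\mathbb{R}^{m+1}$ whose mean curvature vector field $\mathbf{H}=\mathrm{tr}_\Sigma\mathbf{A}$ (trace of the vector-valued second fundamental form) satisfies $x^\perp=-\mathbf{H}$, where $(\cdot)^\perp$ is the orthogonal projection onto the normal bundle. Hypersurfaces are nonempty and without boundary. A regular normal tubular neighborhood of $\Sigma_2$ with ray (width) function $R:\Sigma_2\to(0,+\infty)$ is the image $\mathcal{T}(\Sigma_2)$ of the set $\{(z,s): z\in\Sigma_2,\ |s|<R(z)\}$ under the normal exponential map $(z,s)\mapsto z+s\,\nu(z)$, where $\nu$ is a unit normal field on $\Sigma_2$, this map being required to be a diffeomorphism of that set onto its image; $R(z)$ is the ray of $\mathcal{T}(\Sigma_2)$ at $z$. *)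

theory Defs
  imports "HOL-Analysis.Analysis" "HOL-Computational_Algebra.Polynomial"
begin

section \<open>Smooth maps\<close>

text \<open>\<open>C\<^sup>k\<close> maps on an open set \<open>U\<close>, via iterated directional derivatives.\<close>

primrec Ck_on :: "nat \<Rightarrow> 'a::real_normed_vector set \<Rightarrow> ('a \<Rightarrow> 'b::real_normed_vector) \<Rightarrow> bool" where
  "Ck_on 0 U f \<longleftrightarrow> continuous_on U f"
| "Ck_on (Suc k) U f \<longleftrightarrow>
     (\<forall>x\<in>U. f differentiable at x) \<and> (\<forall>v. Ck_on k U (\<lambda>x. frechet_derivative f (at x) v))"

definition smooth_on :: "'a::real_normed_vector set \<Rightarrow> ('a \<Rightarrow> 'b::real_normed_vector) \<Rightarrow> bool" where
  "smooth_on U f \<longleftrightarrow> (\<forall>k. Ck_on k U f)"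

text \<open>On an arbitrary subset \<open>A\<close>, smoothness means local extendability to smooth maps on open
  sets; this is the usual convention for subsets of Euclidean spaces. It agrees with
  \<^const>\<open>smooth_on\<close> when \<open>A\<close> is open, and with intrinsic smoothness when \<open>A\<close> is an embedded
  submanifold.\<close>

definition smooth_map_on :: "'a::real_normed_vector set \<Rightarrow> ('a \<Rightarrow> 'b::real_normed_vector) \<Rightarrow> bool" where
  "smooth_map_on A f \<longleftrightarrow>
     (\<forall>x\<in>A. \<exists>U g. open U \<and> x \<in> U \<and> smooth_on U g \<and> (\<forall>y\<in>U \<inter> A. g y = f y))"

definition diffeomorphism_onto ::
    "'a::real_normed_vector set \<Rightarrow> 'b::real_normed_vector set \<Rightarrow> ('a \<Rightarrow> 'b) \<Rightarrow> bool" where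
  "diffeomorphism_onto A B f \<longleftrightarrow>
     bij_betw f A B \<and> smooth_map_on A f \<and> smooth_map_on B (the_inv_into A f)"

section \<open>Embedded submanifolds and their extrinsic geometry\<close>

text \<open>Slice charts: near each of its points, \<open>S\<close> is carried by an ambient diffeomorphism to a piece
  of an \<open>m\<close>-dimensional linear subspace. In particular \<open>S\<close> has no boundary.\<close>

definition embedded_submanifold :: "nat \<Rightarrow> 'a::euclidean_space set \<Rightarrow> bool" where
  "embedded_submanifold m S \<longleftrightarrow>
     (\<forall>p\<in>S. \<exists>U (V :: 'a set) \<Phi> L. open U \<and> p \<in> U \<and> open V \<and> diffeomorphism_onto U V \<Phi> \<and>
        subspace L \<and> dim L = m \<and> \<Phi> ` (S \<inter> U) = V \<inter> L)"

text \<open>Properness of the inclusion map: preimages of compact sets are compact.\<close>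

definition properly_embedded :: "'a::euclidean_space set \<Rightarrow> bool" where
  "properly_embedded S \<longleftrightarrow> (\<forall>K. compact K \<longrightarrow> compact (S \<inter> K))"

definition tangent_subspace :: "'a::euclidean_space set \<Rightarrow> 'a \<Rightarrow> 'a set" where
  "tangent_subspace S p =
     {v. \<exists>\<epsilon>>0. \<exists>\<gamma>::real \<Rightarrow> 'a. smooth_on {-\<epsilon><..<\<epsilon>} \<gamma> \<and> \<gamma> ` {-\<epsilon><..<\<epsilon>} \<subseteq> S \<and> \<gamma> 0 = p \<and>
          (\<gamma> has_vector_derivative v) (at 0)}"

definition normal_subspace :: "'a::euclidean_space set \<Rightarrow> 'a \<Rightarrow> 'a set" where
  "normal_subspace S p = (tangent_subspace S p)\<^sup>\<bottom>"

definition orthogonal_projection :: "'a::euclidean_space set \<Rightarrow> 'a \<Rightarrow> 'a" where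
  "orthogonal_projection W v = (THE w. w \<in> W \<and> v - w \<in> W\<^sup>\<bottom>)"

text \<open>\<open>Y\<close> is, near \<open>p\<close>, an ambient smooth vector field that is tangent to \<open>S\<close> along \<open>S\<close> and takes
  the value \<open>v\<close> at \<open>p\<close>.\<close>

definition tangent_extension :: "'a::euclidean_space set \<Rightarrow> 'a \<Rightarrow> 'a \<Rightarrow> ('a \<Rightarrow> 'a) \<Rightarrow> bool" where
  "tangent_extension S p v Y \<longleftrightarrow> Y p = v \<and>
     (\<exists>U. open U \<and> p \<in> U \<and> smooth_on U Y \<and> (\<forall>q\<in>S \<inter> U. Y q \<in> tangent_subspace S q))"

text \<open>The vector-valued second fundamental form \<open>A(u,v) = (D\<^sub>u Y)\<^sup>\<bottom>\<close>, for tangent vectors \<open>u\<close>, \<open>v\<close> at a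
  point \<open>p\<close> of an embedded submanifold. The value does not depend on the extension \<open>Y\<close> of \<open>v\<close>.\<close>

definition second_fundamental_form :: "'a::euclidean_space set \<Rightarrow> 'a \<Rightarrow> 'a \<Rightarrow> 'a \<Rightarrow> 'a" where
  "second_fundamental_form S p u v =
     orthogonal_projection (normal_subspace S p)
       (frechet_derivative (SOME Y. tangent_extension S p v Y) (at p) u)"

definition orthonormal_basis_of :: "'a::euclidean_space set \<Rightarrow> 'a set \<Rightarrow> bool" where
  "orthonormal_basis_of W B \<longleftrightarrow>
     B \<subseteq> W \<and> pairwise orthogonal B \<and> (\<forall>e\<in>B. norm e = 1) \<and> span B = W"

text \<open>The trace of the second fundamental form, not divided by the dimension; it does not depend on
  the orthonormal basis.\<close>

definition mean_curvature_vector :: "'a::euclidean_space set \<Rightarrow> 'a \<Rightarrow> 'a" where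
  "mean_curvature_vector S p =
     (\<Sum>e\<in>(SOME B. orthonormal_basis_of (tangent_subspace S p) B). second_fundamental_form S p e e)"

definition self_shrinker :: "nat \<Rightarrow> 'a::euclidean_space set \<Rightarrow> bool" where
  "self_shrinker m S \<longleftrightarrow>
     DIM('a) = m + 1 \<and> S \<noteq> {} \<and> embedded_submanifold m S \<and>
     (\<forall>x\<in>S. orthogonal_projection (normal_subspace S x) x = - mean_curvature_vector S x)"

section \<open>Normal tubular neighborhoods\<close>

definition unit_normal_field :: "'a::euclidean_space set \<Rightarrow> ('a \<Rightarrow> 'a) \<Rightarrow> bool" where
  "unit_normal_field S \<nu> \<longleftrightarrow>
     smooth_map_on S \<nu> \<and> (\<forall>z\<in>S. norm (\<nu> z) = 1 \<and> \<nu> z \<in> normal_subspace S z)"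

definition normal_exp :: "('a::euclidean_space \<Rightarrow> 'a) \<Rightarrow> 'a \<times> real \<Rightarrow> 'a" where
  "normal_exp \<nu> = (\<lambda>(z, s). z + s *\<^sub>R \<nu> z)"

definition tube_domain :: "'a::euclidean_space set \<Rightarrow> ('a \<Rightarrow> real) \<Rightarrow> ('a \<times> real) set" where
  "tube_domain S R = {(z, s). z \<in> S \<and> \<bar>s\<bar> < R z}"

text \<open>\<open>T\<close> is a regular normal tubular neighborhood of \<open>S\<close> with ray function \<open>R\<close>. No regularity of
  \<open>R\<close> beyond positivity is imposed.\<close>

definition regular_tubular_neighborhood ::
    "'a::euclidean_space set \<Rightarrow> ('a \<Rightarrow> 'a) \<Rightarrow> ('a \<Rightarrow> real) \<Rightarrow> 'a set \<Rightarrow> bool" where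
  "regular_tubular_neighborhood S \<nu> R T \<longleftrightarrow>
     unit_normal_field S \<nu> \<and> (\<forall>z\<in>S. 0 < R z) \<and> T = normal_exp \<nu> ` tube_domain S R \<and>
     diffeomorphism_onto (tube_domain S R) T (normal_exp \<nu>)"

section \<open>Behavior at infinity along a set\<close>

text \<open>The filter of \<open>|z| \<rightarrow> \<infinity>\<close>, \<open>z \<in> S\<close>. For bounded \<open>S\<close> it is trivial, and lower limits along it
  are \<open>\<infinity>\<close>.\<close>

definition at_infinity_within :: "'a::euclidean_space set \<Rightarrow> 'a filter" where
  "at_infinity_within S = inf at_infinity (principal S)"

end

theory Submission
  imports Defs
begin

text \<open>
  The proof is a static form of Ilmanen's localized avoidance principle. Both self-shrinkers move under
  mean curvature flow by homotheties, and two disjoint flows stay disjoint inside a slowly shrinking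
  ball: their hyperbolic distance in that ball does not decrease. After rescaling to fixed
  hypersurfaces the time becomes a parameter \<open>r\<close>, and disjointness means that
  \<open>(r - m - 1) |x - y|\<^sup>2 > \<mu> (r - |x|\<^sup>2) (r - |y|\<^sup>2)\<close> for \<open>x \<in> \<Sigma>\<^sub>1\<close> and \<open>y \<in> \<Sigma>\<^sub>2\<close> in the ball of radius
  \<open>\<surd>r\<close>. For disjoint surfaces this holds at some \<open>r\<close> when \<open>\<mu>\<close> is small, and it always fails for large
  \<open>r\<close>, so there is a first \<open>r\<close> at which it fails. There the second variation at the touching pair,
  summed over an orthonormal frame, contradicts the shrinker equation.
\<close>

section \<open>Calculus of smooth maps\<close>

lemma frechet_derivative_eqI:
  "(f has_derivative f') (at x) \<Longrightarrow> frechet_derivative f (at x) = f'"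
  by (metis frechet_derivative_at)

section \<open>Restriction, congruence and locality of C^k maps\<close>

lemma Ck_on_subset: "Ck_on k U f \<Longrightarrow> V \<subseteq> U \<Longrightarrow> Ck_on k V f"
  by (induction k arbitrary: f) (auto intro: continuous_on_subset)

lemma Ck_on_SucD: "Ck_on (Suc k) U f \<Longrightarrow> Ck_on k U f"
proof (induction k arbitrary: f)
  case 0
  then show ?case
    by (auto intro!: continuous_at_imp_continuous_on differentiable_imp_continuous_within)
next
  case (Suc k)
  from Suc.prems have d: "\<forall>x\<in>U. f differentiable at x"
    and s: "Ck_on (Suc k) U (\<lambda>x. frechet_derivative f (at x) v)" for v
    unfolding Ck_on.simps(2)[of "Suc k"] by blast+
  show ?case using d Suc.IH[OF s] by simp
qed

lemma Ck_on_SucI: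
  assumes "\<And>x. x \<in> U \<Longrightarrow> (f has_derivative f' x) (at x)"
    and "\<And>v. Ck_on k U (\<lambda>x. frechet_derivative f (at x) v)"
  shows "Ck_on (Suc k) U f"
  using assms by (auto intro: differentiableI)

lemma Ck_on_Suc_has_derivative:
  "Ck_on (Suc k) U f \<Longrightarrow> x \<in> U \<Longrightarrow> (f has_derivative frechet_derivative f (at x)) (at x)"
  by (simp add: frechet_derivative_works[symmetric])

lemma Ck_on_frechet_derivative:
  "Ck_on (Suc k) U f \<Longrightarrow> Ck_on k U (\<lambda>x. frechet_derivative f (at x) v)"
  by simp

text \<open>The derivative at a point depends on a whole neighborhood, so agreement is required on
  an open set in order to pass to the next order.\<close>

lemma Ck_on_cong:
  assumes "open U" "\<And>x. x \<in> U \<Longrightarrow> f x = g x" "Ck_on k U f"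
  shows "Ck_on k U g"
  using assms(2,3)
proof (induction k arbitrary: f g)
  case 0
  then show ?case by (metis Ck_on.simps(1) continuous_on_cong)
next
  case (Suc k)
  have d: "(g has_derivative frechet_derivative f (at x)) (at x)" if "x \<in> U" for x
    by (rule has_derivative_transform_within_open[OF Ck_on_Suc_has_derivative[OF Suc.prems(2) that] assms(1) that
          Suc.prems(1)])
  show ?case
  proof (rule Ck_on_SucI[OF d])
    fix v
    show "Ck_on k U (\<lambda>x. frechet_derivative g (at x) v)"
    proof (rule Suc.IH)
      show "Ck_on k U (\<lambda>x. frechet_derivative f (at x) v)" using Suc.prems(2) by simp
    qed (simp add: frechet_derivative_eqI[OF d])
  qed
qed

text \<open>Working introduction rule: an explicit derivative \<open>f'\<close> takes the place of
  \<open>frechet_derivative\<close>, with which it agrees by uniqueness.\<close>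

lemma Ck_on_has_derivativeI:
  assumes "open U" "\<And>x. x \<in> U \<Longrightarrow> (f has_derivative f' x) (at x)"
    and "\<And>v. Ck_on k U (\<lambda>x. f' x v)"
  shows "Ck_on (Suc k) U f"
proof (rule Ck_on_SucI[OF assms(2)])
  fix v
  show "Ck_on k U (\<lambda>x. frechet_derivative f (at x) v)"
    by (rule Ck_on_cong[OF assms(1) _ assms(3)]) (simp add: frechet_derivative_eqI[OF assms(2)])
qed

lemma Ck_on_localI:
  assumes "\<And>x. x \<in> U \<Longrightarrow> \<exists>V. open V \<and> x \<in> V \<and> Ck_on k V f"
  shows "Ck_on k U f"
  using assms
proof (induction k arbitrary: f)
  case 0
  have "isCont f x" if "x \<in> U" for x
    using 0[OF that] by (auto simp: continuous_on_eq_continuous_at)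
  then show ?case by (simp add: continuous_at_imp_continuous_on)
next
  case (Suc k)
  have "f differentiable at x" if "x \<in> U" for x
    using Suc.prems[OF that] by auto
  moreover have "Ck_on k U (\<lambda>x. frechet_derivative f (at x) v)" for v
  proof (rule Suc.IH)
    fix x assume "x \<in> U"
    from Suc.prems[OF this] show "\<exists>V. open V \<and> x \<in> V \<and> Ck_on k V (\<lambda>x. frechet_derivative f (at x) v)"
      by auto
  qed
  ultimately show ?case by simp
qed

text \<open>On an open domain the local extensions coincide with \<open>f\<close> on open
  neighborhoods, and being C^k is a local property.\<close>

lemma smooth_map_on_imp_smooth_on:
  assumes "open U" "smooth_map_on U f"
  shows "smooth_on U f"
  unfolding smooth_on_def
proof (intro allI Ck_on_localI)
  fix k x assume "x \<in> U"
  then obtain V g where V: "open V" "x \<in> V" "smooth_on V g" "\<forall>y\<in>V \<inter> U. g y = f y"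
    using assms(2) unfolding smooth_map_on_def by blast
  have "Ck_on k (V \<inter> U) f"
  proof (rule Ck_on_cong)
    show "Ck_on k (V \<inter> U) g"
      using V(3) by (meson Ck_on_subset Int_lower1 smooth_on_def)
  qed (use V assms(1) in auto)
  then show "\<exists>V. open V \<and> x \<in> V \<and> Ck_on k V f"
    using V(1,2) \<open>x \<in> U\<close> assms(1) by blast
qed

section \<open>Closure of C^k maps under sums, products and composition\<close>

lemma Ck_on_const: "Ck_on k U (\<lambda>_. c)"
  by (induction k arbitrary: c) auto

lemma Ck_on_add:
  assumes "open U" "Ck_on k U f" "Ck_on k U g"
  shows "Ck_on k U (\<lambda>x. f x + g x)"
  using assms(2,3)
proof (induction k arbitrary: f g)
  case 0
  then show ?case by (simp add: continuous_on_add)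
next
  case (Suc k)
  show ?case
  proof (rule Ck_on_has_derivativeI[OF assms(1)])
    fix x assume x: "x \<in> U"
    show "((\<lambda>x. f x + g x) has_derivative
        (\<lambda>v. frechet_derivative f (at x) v + frechet_derivative g (at x) v)) (at x)"
      by (intro has_derivative_add Suc.prems[THEN Ck_on_Suc_has_derivative, OF x])
  qed (intro Suc.IH Suc.prems[THEN Ck_on_frechet_derivative])
qed

lemma Ck_on_sum:
  assumes "open U" "\<And>i. i \<in> I \<Longrightarrow> Ck_on k U (f i)"
  shows "Ck_on k U (\<lambda>x. \<Sum>i\<in>I. f i x)"
  using assms(2) by (induction I rule: infinite_finite_induct) (auto intro: Ck_on_const Ck_on_add[OF assms(1)])

lemma (in bounded_bilinear) Ck_on:
  assumes "open U" "Ck_on k U f" "Ck_on k U g"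
  shows "Ck_on k U (\<lambda>x. prod (f x) (g x))"
  using assms(2,3)
proof (induction k arbitrary: f g)
  case 0
  then show ?case by (simp add: continuous_on)
next
  case (Suc k)
  show ?case
  proof (rule Ck_on_has_derivativeI[OF assms(1)])
    fix x assume x: "x \<in> U"
    show "((\<lambda>x. prod (f x) (g x)) has_derivative
        (\<lambda>v. prod (f x) (frechet_derivative g (at x) v) + prod (frechet_derivative f (at x) v) (g x))) (at x)"
      by (intro FDERIV Suc.prems[THEN Ck_on_Suc_has_derivative, OF x])
  qed (intro Ck_on_add[OF assms(1)] Suc.IH Suc.prems[THEN Ck_on_frechet_derivative]
      Suc.prems[THEN Ck_on_SucD])
qed

lemma linear_eq_sum_Basis:
  fixes f :: "'a::euclidean_space \<Rightarrow> 'b::real_vector"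
  assumes "linear f"
  shows "f v = (\<Sum>b\<in>Basis. (v \<bullet> b) *\<^sub>R f b)"
proof -
  have "f v = f (\<Sum>b\<in>Basis. (v \<bullet> b) *\<^sub>R b)" by (simp add: euclidean_representation)
  then show ?thesis by (simp add: linear_sum[OF assms] linear_scale[OF assms])
qed

text \<open>\<open>Ck_on\<close> controls derivatives in fixed directions only, while the chain rule
  differentiates \<open>f\<close> in a moving direction, given by the derivative of
  \<open>g\<close>. Expanding that direction in \<open>Basis\<close> yields sums of products to
  which the induction hypothesis applies.\<close>

lemma Ck_on_compose:
  fixes g :: "'a::real_normed_vector \<Rightarrow> 'b::euclidean_space"
    and f :: "'b \<Rightarrow> 'c::real_normed_vector"
  assumes "open U" "g ` U \<subseteq> V" "Ck_on k V f" "Ck_on k U g"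
  shows "Ck_on k U (\<lambda>x. f (g x))"
  using assms(3,4)
proof (induction k arbitrary: f)
  case 0
  then show ?case using assms(2) by (auto intro: continuous_on_compose2)
next
  case (Suc k)
  let ?f' = "\<lambda>y. frechet_derivative f (at y)" and ?g' = "\<lambda>x. frechet_derivative g (at x)"
  have dg: "(g has_derivative ?g' x) (at x)" if "x \<in> U" for x
    using Ck_on_Suc_has_derivative[OF Suc.prems(2) that] .
  have df: "(f has_derivative ?f' (g x)) (at (g x))" if "x \<in> U" for x
    using Ck_on_Suc_has_derivative[OF Suc.prems(1)] that assms(2) by blast
  have d: "((\<lambda>x. f (g x)) has_derivative (\<lambda>v. \<Sum>b\<in>Basis. (?g' x v \<bullet> b) *\<^sub>R ?f' (g x) b)) (at x)"
    if "x \<in> U" for x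
    by (rule has_derivative_eq_rhs[OF has_derivative_compose[OF dg[OF that] df[OF that]]],
        rule ext, rule linear_eq_sum_Basis[OF has_derivative_linear[OF df[OF that]]])
  show ?case
  proof (rule Ck_on_has_derivativeI[OF assms(1) d])
    show "Ck_on k U (\<lambda>x. \<Sum>b\<in>Basis. (?g' x v \<bullet> b) *\<^sub>R ?f' (g x) b)" for v
      by (intro Ck_on_sum bounded_bilinear.Ck_on[OF bounded_bilinear_scaleR]
        bounded_bilinear.Ck_on[OF bounded_bilinear_inner] Ck_on_const Suc.IH assms(1)
        Ck_on_SucD[OF Suc.prems(2)] Suc.prems[THEN Ck_on_frechet_derivative])
  qed
qed

lemma smooth_on_compose:
  fixes g :: "'a::real_normed_vector \<Rightarrow> 'b::euclidean_space"
  assumes "open U" "g ` U \<subseteq> V" "smooth_on V f" "smooth_on U g"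
  shows "smooth_on U (\<lambda>x. f (g x))"
  using assms(3,4) Ck_on_compose[OF assms(1,2)] unfolding smooth_on_def by blast

lemma smooth_on_affine: "smooth_on U (\<lambda>s. a + s *\<^sub>R (v::'a::real_normed_vector))"
proof -
  have "Ck_on k UNIV (\<lambda>s. a + s *\<^sub>R v)" for k
  proof (cases k)
    case (Suc j)
    show ?thesis
      unfolding Suc
      by (rule Ck_on_has_derivativeI[where f'="\<lambda>_ h. h *\<^sub>R v"])
        (auto intro!: derivative_eq_intros Ck_on_const)
  qed (auto intro!: continuous_intros)
  then show ?thesis unfolding smooth_on_def by (blast intro: Ck_on_subset)
qed

lemma smooth_on_has_derivative:
  "smooth_on U f \<Longrightarrow> x \<in> U \<Longrightarrow> (f has_derivative frechet_derivative f (at x)) (at x)"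
  unfolding smooth_on_def by (rule Ck_on_Suc_has_derivative[of 0]) (auto simp del: Ck_on.simps)

lemma smooth_on_frechet_derivative:
  "smooth_on U f \<Longrightarrow> smooth_on U (\<lambda>x. frechet_derivative f (at x) v)"
  unfolding smooth_on_def by (blast intro: Ck_on_frechet_derivative)

lemma smooth_on_imp_continuous_on: "smooth_on U f \<Longrightarrow> continuous_on U f"
  unfolding smooth_on_def by (metis Ck_on.simps(1))

section \<open>Slice charts\<close>

text \<open>Orthogonal decomposition supplies the unique element behind \<open>THE\<close>; the
  remainder is orthogonal to \<open>W\<close>, so pairing with \<open>n\<close> does not see
  it.\<close>

lemma orthogonal_projection_inner:
  assumes "subspace W" "n \<in> W"
  shows "orthogonal_projection W x \<bullet> n = x \<bullet> n"
proof -
  obtain y z where y: "y \<in> W" "\<And>w. w \<in> W \<Longrightarrow> orthogonal z w" "x = y + z"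
    using orthogonal_subspace_decomp_exists[of W x] span_eq_iff[THEN iffD2, OF assms(1)] by metis
  have "orthogonal_projection W x = y"
    unfolding orthogonal_projection_def
  proof (rule the_equality)
    show "y \<in> W \<and> x - y \<in> W\<^sup>\<bottom>"
      using y by (auto simp: orthogonal_comp_def orthogonal_commute)
  next
    fix w assume w: "w \<in> W \<and> x - w \<in> W\<^sup>\<bottom>"
    have "w - y \<in> W" using w y(1) assms(1) by (simp add: subspace_diff)
    then have "(w - y) \<bullet> (x - w) = 0" "z \<bullet> (w - y) = 0"
      using w y(2) by (auto simp: orthogonal_comp_def orthogonal_def)
    then have "(w - y) \<bullet> (w - y) = 0"
      unfolding y(3) by (simp add: algebra_simps inner_commute)
    then show "w = y" by simp
  qed
  then show ?thesis using y(2)[OF assms(2)] y(3) by (simp add: orthogonal_def inner_add_left)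
qed

lemma has_vector_derivative_difference_quotient:
  assumes "(g has_vector_derivative v) (at 0)"
  shows "((\<lambda>s. (g s - g 0) /\<^sub>R s) \<longlongrightarrow> v) (at 0)"
proof -
  have lim: "((\<lambda>s. norm (g s - g 0 - s *\<^sub>R v) / norm s) \<longlongrightarrow> 0) (at 0)"
    using assms unfolding has_vector_derivative_def has_derivative_at by simp
  have eq: "norm (g s - g 0 - s *\<^sub>R v) / norm s = norm ((g s - g 0) /\<^sub>R s - v)" if "s \<noteq> 0" for s
  proof -
    have "g s - g 0 - s *\<^sub>R v = s *\<^sub>R ((g s - g 0) /\<^sub>R s - v)"
      using that by (simp add: scaleR_diff_right)
    then have "norm (g s - g 0 - s *\<^sub>R v) = norm s * norm ((g s - g 0) /\<^sub>R s - v)"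
      by (metis norm_scaleR real_norm_def)
    then show ?thesis using that by simp
  qed
  have "((\<lambda>s. norm ((g s - g 0) /\<^sub>R s - v)) \<longlongrightarrow> 0) (at 0)"
    by (rule Lim_transform_eventually[OF lim])
      (unfold eventually_at_filter, rule always_eventually, use eq in blast)
  then show ?thesis
    by (simp add: tendsto_norm_zero_iff LIM_zero_iff)
qed

text \<open>The difference quotients lie in \<open>L\<close>, and a finite-dimensional subspace is
  closed.\<close>

lemma vector_derivative_in_subspace:
  fixes L :: "'a::euclidean_space set"
  assumes "subspace L" "(g has_vector_derivative v) (at 0)" "g 0 \<in> L" "\<forall>\<^sub>F s in at 0. g s \<in> L"
  shows "v \<in> L"
proof (rule Lim_in_closed_set)
  show "\<forall>\<^sub>F s in at 0. (g s - g 0) /\<^sub>R s \<in> L"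
    using assms(4) by eventually_elim (simp add: assms subspace_diff subspace_scale)
qed (use assms in \<open>auto intro: closed_subspace has_vector_derivative_difference_quotient\<close>)

text \<open>A slice chart together with its inverse \<open>\<Psi>\<close>, both smooth on open sets
  of the ambient space, so that their derivatives are mutually inverse linear maps.\<close>

locale slice_chart =
  fixes S U V :: "'a::euclidean_space set" and \<Phi> \<Psi> :: "'a \<Rightarrow> 'a" and L :: "'a set"
  assumes open_U: "open U" and open_V: "open V"
    and smooth_\<Phi>: "smooth_on U \<Phi>" and smooth_\<Psi>: "smooth_on V \<Psi>"
    and \<Phi>_in: "x \<in> U \<Longrightarrow> \<Phi> x \<in> V" and \<Psi>_in: "y \<in> V \<Longrightarrow> \<Psi> y \<in> U"
    and \<Psi>_\<Phi>: "x \<in> U \<Longrightarrow> \<Psi> (\<Phi> x) = x" and \<Phi>_\<Psi>: "y \<in> V \<Longrightarrow> \<Phi> (\<Psi> y) = y"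
    and subspace_L: "subspace L" and slice: "\<Phi> ` (S \<inter> U) = V \<inter> L"

lemma embedded_submanifold_slice_chart:
  assumes "embedded_submanifold m S" "p \<in> S"
  obtains U V \<Phi> \<Psi> L where "slice_chart S U V \<Phi> \<Psi> L" "p \<in> U" "dim L = m"
proof -
  obtain U V :: "'a set" and \<Phi> :: "'a \<Rightarrow> 'a" and L where c: "open U" "p \<in> U" "open V" "diffeomorphism_onto U V \<Phi>"
      "subspace L" "dim L = m" "\<Phi> ` (S \<inter> U) = V \<inter> L"
    using assms unfolding embedded_submanifold_def by metis
  have b: "bij_betw \<Phi> U V" and s: "smooth_map_on U \<Phi>" "smooth_map_on V (the_inv_into U \<Phi>)"
    using c(4) unfolding diffeomorphism_onto_def by auto
  have "slice_chart S U V \<Phi> (the_inv_into U \<Phi>) L"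
  proof
    show "\<Phi> x \<in> V" "the_inv_into U \<Phi> (\<Phi> x) = x" if "x \<in> U" for x
      using b that by (auto simp: bij_betw_def the_inv_into_f_f)
    show "the_inv_into U \<Phi> y \<in> U" "\<Phi> (the_inv_into U \<Phi> y) = y" if "y \<in> V" for y
      using b that by (auto simp: bij_betw_def f_the_inv_into_f intro: the_inv_into_into)
  qed (use c s in \<open>auto intro: smooth_map_on_imp_smooth_on\<close>)
  with c show thesis using that by blast
qed

context slice_chart
begin

abbreviation D\<Phi> :: "'a \<Rightarrow> 'a \<Rightarrow> 'a" where "D\<Phi> x \<equiv> frechet_derivative \<Phi> (at x)"
abbreviation D\<Psi> :: "'a \<Rightarrow> 'a \<Rightarrow> 'a" where "D\<Psi> y \<equiv> frechet_derivative \<Psi> (at y)"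

lemma \<Phi>_in_L_iff:
  assumes "x \<in> U"
  shows "\<Phi> x \<in> L \<longleftrightarrow> x \<in> S"
proof
  assume "\<Phi> x \<in> L"
  then have "\<Phi> x \<in> \<Phi> ` (S \<inter> U)" using slice \<Phi>_in[OF assms] by simp
  then obtain y where y: "y \<in> S" "y \<in> U" "\<Phi> x = \<Phi> y" by auto
  have "x = y" using \<Psi>_\<Phi>[OF assms] \<Psi>_\<Phi>[OF y(2)] unfolding y(3) by (rule trans[OF sym])
  then show "x \<in> S" using y(1) by blast
next
  assume "x \<in> S"
  then have "\<Phi> x \<in> \<Phi> ` (S \<inter> U)" using assms by simp
  then show "\<Phi> x \<in> L" using slice by simp
qed

section \<open>Derivatives of the chart and tangent spaces\<close>

lemma has_derivative_\<Phi>: "x \<in> U \<Longrightarrow> (\<Phi> has_derivative D\<Phi> x) (at x)"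
  by (rule smooth_on_has_derivative[OF smooth_\<Phi>])

lemma has_derivative_\<Psi>: "y \<in> V \<Longrightarrow> (\<Psi> has_derivative D\<Psi> y) (at y)"
  by (rule smooth_on_has_derivative[OF smooth_\<Psi>])

lemma D\<Psi>_D\<Phi>:
  assumes "x \<in> U"
  shows "D\<Psi> (\<Phi> x) (D\<Phi> x v) = v"
proof -
  have "((\<lambda>x. \<Psi> (\<Phi> x)) has_derivative (\<lambda>v. D\<Psi> (\<Phi> x) (D\<Phi> x v))) (at x)"
    by (rule has_derivative_compose[OF has_derivative_\<Phi>[OF assms] has_derivative_\<Psi>[OF \<Phi>_in[OF assms]]])
  then have "((\<lambda>x. x) has_derivative (\<lambda>v. D\<Psi> (\<Phi> x) (D\<Phi> x v))) (at x)"
    by (rule has_derivative_transform_within_open[OF _ open_U assms \<Psi>_\<Phi>])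
  from has_derivative_unique[OF this has_derivative_ident] show ?thesis by metis
qed

lemma D\<Phi>_D\<Psi>:
  assumes "y \<in> V"
  shows "D\<Phi> (\<Psi> y) (D\<Psi> y v) = v"
proof -
  have "((\<lambda>y. \<Phi> (\<Psi> y)) has_derivative (\<lambda>v. D\<Phi> (\<Psi> y) (D\<Psi> y v))) (at y)"
    by (rule has_derivative_compose[OF has_derivative_\<Psi>[OF assms] has_derivative_\<Phi>[OF \<Psi>_in[OF assms]]])
  then have "((\<lambda>y. y) has_derivative (\<lambda>v. D\<Phi> (\<Psi> y) (D\<Psi> y v))) (at y)"
    by (rule has_derivative_transform_within_open[OF _ open_V assms \<Phi>_\<Psi>])
  from has_derivative_unique[OF this has_derivative_ident] show ?thesis by metis
qed

lemma linear_D\<Phi>: "x \<in> U \<Longrightarrow> linear (D\<Phi> x)"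
  using has_derivative_\<Phi> has_derivative_linear by blast

lemma linear_D\<Psi>: "y \<in> V \<Longrightarrow> linear (D\<Psi> y)"
  using has_derivative_\<Psi> has_derivative_linear by blast

text \<open>The straight segment through \<open>\<Phi> q\<close> in direction
  \<open>D\<Phi> q v\<close> stays in the slice, and \<open>\<Psi>\<close> pulls it back to
  \<open>S\<close>. The velocity is recorded at every \<open>s\<close>, not only at 0, because the
  acceleration is read off from it later.\<close>

lemma tangent_curve:
  assumes q: "q \<in> S \<inter> U" and v: "D\<Phi> q v \<in> L"
  obtains \<epsilon> \<gamma> where "\<epsilon> > 0" "smooth_on {-\<epsilon><..<\<epsilon>} \<gamma>" "\<gamma> ` {-\<epsilon><..<\<epsilon>} \<subseteq> S \<inter> U" "\<gamma> 0 = q"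
    "\<forall>s\<in>{-\<epsilon><..<\<epsilon>}. (\<gamma> has_vector_derivative D\<Psi> (\<Phi> (\<gamma> s)) (D\<Phi> q v)) (at s)"
proof -
  define l where "l = D\<Phi> q v"
  define \<gamma> where "\<gamma> = (\<lambda>s. \<Psi> (\<Phi> q + s *\<^sub>R l))"
  have "\<Phi> q \<in> V" using q \<Phi>_in by simp
  then obtain e where e: "e > 0" "ball (\<Phi> q) e \<subseteq> V"
    using open_V open_contains_ball by blast
  \<comment> \<open>The summand 1 keeps the quotient positive also for \<open>l = 0\<close>.\<close>
  define \<epsilon> where "\<epsilon> = e / (norm l + 1)"
  have pos: "norm l + 1 > 0" using norm_ge_zero[of l] by linarith
  then have "\<epsilon> > 0" using e(1) by (simp add: \<epsilon>_def)
  have inV: "\<Phi> q + s *\<^sub>R l \<in> V" if "s \<in> {-\<epsilon><..<\<epsilon>}" for s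
  proof -
    have "\<bar>s\<bar> < \<epsilon>" using that by auto
    have "\<bar>s\<bar> * norm l \<le> \<bar>s\<bar> * (norm l + 1)" by (simp add: mult_left_mono)
    also have "\<dots> < e" using \<open>\<bar>s\<bar> < \<epsilon>\<close> pos by (simp add: \<epsilon>_def pos_less_divide_eq)
    finally show ?thesis using e(2) by (auto simp: dist_norm)
  qed
  have \<Phi>\<gamma>: "\<Phi> (\<gamma> s) = \<Phi> q + s *\<^sub>R l" if "s \<in> {-\<epsilon><..<\<epsilon>}" for s
    unfolding \<gamma>_def by (rule \<Phi>_\<Psi>[OF inV[OF that]])
  have in_U: "\<gamma> s \<in> U" if "s \<in> {-\<epsilon><..<\<epsilon>}" for s
    unfolding \<gamma>_def by (rule \<Psi>_in[OF inV[OF that]])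
  have "\<Phi> q \<in> L" using q \<Phi>_in_L_iff by simp
  then have "\<Phi> (\<gamma> s) \<in> L" if "s \<in> {-\<epsilon><..<\<epsilon>}" for s
    unfolding \<Phi>\<gamma>[OF that] l_def using v subspace_L by (simp add: subspace_add subspace_scale)
  then have in_S: "\<gamma> s \<in> S" if "s \<in> {-\<epsilon><..<\<epsilon>}" for s
    using \<Phi>_in_L_iff in_U that by blast
  show thesis
  proof (rule that[OF \<open>\<epsilon> > 0\<close>])
    show "smooth_on {-\<epsilon><..<\<epsilon>} \<gamma>"
      unfolding \<gamma>_def using inV
      by (intro smooth_on_compose[where V=V, OF _ _ smooth_\<Psi>] smooth_on_affine) auto
    show "\<gamma> ` {-\<epsilon><..<\<epsilon>} \<subseteq> S \<inter> U" using in_S in_U by blast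
    show "\<gamma> 0 = q" using q by (simp add: \<gamma>_def \<Psi>_\<Phi>)
    show "\<forall>s\<in>{-\<epsilon><..<\<epsilon>}. (\<gamma> has_vector_derivative D\<Psi> (\<Phi> (\<gamma> s)) (D\<Phi> q v)) (at s)"
    proof
      fix s assume that: "s \<in> {-\<epsilon><..<\<epsilon>}"
      have "((\<lambda>s. \<Phi> q + s *\<^sub>R l) has_vector_derivative l) (at s)"
        by (auto intro!: derivative_eq_intros simp: has_vector_derivative_def)
      from vector_derivative_diff_chain_within[OF this has_derivative_at_withinI[OF has_derivative_\<Psi>[OF inV[OF that]]]]
      show "(\<gamma> has_vector_derivative D\<Psi> (\<Phi> (\<gamma> s)) (D\<Phi> q v)) (at s)"
        unfolding \<Phi>\<gamma>[OF that] l_def[symmetric] by (simp add: comp_def \<gamma>_def)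
    qed
  qed
qed

text \<open>One inclusion differentiates \<open>\<Phi> \<circ> \<gamma>\<close>, which runs in
  \<open>L\<close>; the other uses the pulled-back segment. The chart description makes it evident
  that the velocities of curves form a linear subspace.\<close>

lemma tangent_subspace_eq:
  assumes "q \<in> S" "q \<in> U"
  shows "tangent_subspace S q = {v. D\<Phi> q v \<in> L}"
proof (intro equalityI subsetI)
  fix v assume "v \<in> tangent_subspace S q"
  then obtain \<epsilon> \<gamma> where g: "\<epsilon> > 0" "\<gamma> ` {-\<epsilon><..<\<epsilon>} \<subseteq> S" "\<gamma> 0 = q" "(\<gamma> has_vector_derivative v) (at 0)"
    unfolding tangent_subspace_def by blast
  have "((\<Phi> \<circ> \<gamma>) has_vector_derivative D\<Phi> q v) (at 0)"
    by (rule vector_derivative_diff_chain_within[OF g(4)])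
      (use g(3) assms has_derivative_\<Phi> in \<open>auto intro: has_derivative_at_withinI\<close>)
  moreover have "\<forall>\<^sub>F s in at 0. (\<Phi> \<circ> \<gamma>) s \<in> L"
  proof -
    have "(\<gamma> \<longlongrightarrow> q) (at 0)"
      using has_vector_derivative_continuous[OF g(4)] g(3) by (simp add: continuous_within)
    then have "\<forall>\<^sub>F s in at 0. \<gamma> s \<in> U" using topological_tendstoD open_U assms(2) by blast
    moreover have "\<forall>\<^sub>F s in at 0. s \<in> {-\<epsilon><..<\<epsilon>}"
      using g(1) by (intro eventually_at_in_open') auto
    ultimately show ?thesis
      by eventually_elim (use g(2) \<Phi>_in_L_iff in auto)
  qed
  ultimately show "v \<in> {v. D\<Phi> q v \<in> L}"
    using vector_derivative_in_subspace[OF subspace_L] g(3) assms \<Phi>_in_L_iff by auto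
next
  fix v assume "v \<in> {v. D\<Phi> q v \<in> L}"
  then have "q \<in> S \<inter> U" "D\<Phi> q v \<in> L" using assms by auto
  then obtain \<epsilon> \<gamma> where g: "\<epsilon> > 0" "smooth_on {-\<epsilon><..<\<epsilon>} \<gamma>" "\<gamma> ` {-\<epsilon><..<\<epsilon>} \<subseteq> S \<inter> U" "\<gamma> 0 = q"
    "\<forall>s\<in>{-\<epsilon><..<\<epsilon>}. (\<gamma> has_vector_derivative D\<Psi> (\<Phi> (\<gamma> s)) (D\<Phi> q v)) (at s)"
    by (rule tangent_curve) blast
  have "(\<gamma> has_vector_derivative v) (at 0)"
    using bspec[OF g(5), of 0] g(1,4) assms D\<Psi>_D\<Phi> by simp
  then show "v \<in> tangent_subspace S q"
    unfolding tangent_subspace_def using g(1-4) by blast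
qed

lemma subspace_tangent_subspace:
  assumes "q \<in> S" "q \<in> U"
  shows "subspace (tangent_subspace S q)"
  using linear_subspace_vimage[OF linear_D\<Phi> subspace_L] assms
  by (simp add: tangent_subspace_eq vimage_def)

text \<open>\<open>D\<Psi> (\<Phi> q)\<close> is injective and carries \<open>L\<close> onto the
  tangent space.\<close>

lemma dim_tangent_subspace:
  assumes "q \<in> S" "q \<in> U"
  shows "dim (tangent_subspace S q) = dim L"
proof -
  have V: "\<Phi> q \<in> V" using assms \<Phi>_in by simp
  have "tangent_subspace S q = D\<Psi> (\<Phi> q) ` L"
  proof (intro equalityI subsetI)
    fix v assume "v \<in> tangent_subspace S q"
    then show "v \<in> D\<Psi> (\<Phi> q) ` L"
      using tangent_subspace_eq[OF assms] D\<Psi>_D\<Phi>[OF assms(2), of v] by (metis imageI mem_Collect_eq)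
  next
    fix v assume "v \<in> D\<Psi> (\<Phi> q) ` L"
    then show "v \<in> tangent_subspace S q"
      using tangent_subspace_eq[OF assms] D\<Phi>_D\<Psi>[OF V] \<Psi>_\<Phi>[OF assms(2)] by auto
  qed
  moreover have "inj (D\<Psi> (\<Phi> q))"
    using D\<Phi>_D\<Psi>[OF V] by (metis injI)
  ultimately show ?thesis
    using dim_image_eq[OF linear_D\<Psi>[OF V]] by (metis inj_on_subset subset_UNIV)
qed

text \<open>A vector field along a curve in \<open>S\<close> that is tangent to \<open>S\<close> and vanishes at \<open>p\<close> has a tangent
  derivative at \<open>p\<close>. This makes the second fundamental form independent of the extension.\<close>

lemma tangent_derivative:
  assumes p: "p \<in> S" "p \<in> U" and \<gamma>: "isCont \<gamma> 0" "\<gamma> 0 = p"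
    and Z: "Z 0 = 0" "(Z has_vector_derivative z) (at (0::real))"
    and tan: "\<forall>\<^sub>F s in at 0. \<gamma> s \<in> S \<and> Z s \<in> tangent_subspace S (\<gamma> s)"
  shows "z \<in> tangent_subspace S p"
proof -
  have \<gamma>_tendsto: "(\<gamma> \<longlongrightarrow> p) (at 0)" using \<gamma> by (simp add: isCont_def)
  then have inU: "\<forall>\<^sub>F s in at 0. \<gamma> s \<in> U" using topological_tendstoD open_U p(2) by blast
  have zlim: "((\<lambda>s. Z s /\<^sub>R s) \<longlongrightarrow> z) (at 0)"
    using has_vector_derivative_difference_quotient[OF Z(2)] Z(1) by simp
  have dlim: "((\<lambda>s. D\<Phi> (\<gamma> s) b) \<longlongrightarrow> D\<Phi> p b) (at 0)" for b
  proof -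
    have "isCont (\<lambda>x. D\<Phi> x b) p"
      using smooth_on_imp_continuous_on[OF smooth_on_frechet_derivative[OF smooth_\<Phi>]] open_U p(2)
      by (simp add: continuous_on_eq_continuous_at)
    then show ?thesis using \<gamma>_tendsto isCont_tendsto_compose by blast
  qed
  \<comment> \<open>Continuity of the derivative is available only direction by direction, so the
    quotient of \<open>Z s\<close> by \<open>s\<close> is expanded in \<open>Basis\<close> before
    passing to the limit.\<close>
  have "((\<lambda>s. \<Sum>b\<in>Basis. ((Z s /\<^sub>R s) \<bullet> b) *\<^sub>R D\<Phi> (\<gamma> s) b) \<longlongrightarrow> (\<Sum>b\<in>Basis. (z \<bullet> b) *\<^sub>R D\<Phi> p b)) (at 0)"
    by (intro tendsto_intros zlim dlim)
  also have "(\<Sum>b\<in>Basis. (z \<bullet> b) *\<^sub>R D\<Phi> p b) = D\<Phi> p z"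
    by (rule linear_eq_sum_Basis[OF linear_D\<Phi>[OF p(2)], symmetric])
  finally have lim: "((\<lambda>s. \<Sum>b\<in>Basis. ((Z s /\<^sub>R s) \<bullet> b) *\<^sub>R D\<Phi> (\<gamma> s) b) \<longlongrightarrow> D\<Phi> p z) (at 0)" .
  have "\<forall>\<^sub>F s in at 0. (\<Sum>b\<in>Basis. ((Z s /\<^sub>R s) \<bullet> b) *\<^sub>R D\<Phi> (\<gamma> s) b) \<in> L"
    using inU tan
  proof eventually_elim
    case (elim s)
    have "D\<Phi> (\<gamma> s) (Z s) \<in> L" using elim tangent_subspace_eq by blast
    then have "D\<Phi> (\<gamma> s) (Z s /\<^sub>R s) \<in> L"
      using linear_scale[OF linear_D\<Phi>[of "\<gamma> s"]] elim(1) subspace_L by (simp add: subspace_scale)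
    then show ?case
      using linear_eq_sum_Basis[OF linear_D\<Phi>[of "\<gamma> s"], of "Z s /\<^sub>R s"] elim(1) by simp
  qed
  then have "D\<Phi> p z \<in> L"
    by (rule Lim_in_closed_set[OF closed_subspace[OF subspace_L] _ _ lim]) simp
  then show ?thesis using tangent_subspace_eq[OF p] by simp
qed

section \<open>Chart-constant vector fields and the second fundamental form\<close>

definition extension :: "'a \<Rightarrow> 'a \<Rightarrow> 'a \<Rightarrow> 'a" where
  "extension p v q = D\<Psi> (\<Phi> q) (D\<Phi> p v)"

lemma smooth_on_extension: "smooth_on U (extension p v)"
  unfolding extension_def
  by (rule smooth_on_compose[OF open_U _ smooth_on_frechet_derivative[OF smooth_\<Psi>] smooth_\<Phi>])
    (auto intro: \<Phi>_in)

text \<open>In the chart the field is the constant vector \<open>D\<Phi> p v\<close> of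
  \<open>L\<close>, hence tangent along the whole slice.\<close>

lemma tangent_extension_extension:
  assumes "p \<in> S" "p \<in> U" "v \<in> tangent_subspace S p"
  shows "tangent_extension S p v (extension p v)"
proof -
  have "extension p v q \<in> tangent_subspace S q" if "q \<in> S" "q \<in> U" for q
    using assms D\<Phi>_D\<Psi>[OF \<Phi>_in[OF that(2)]] \<Psi>_\<Phi>[OF that(2)] that
    by (simp add: extension_def tangent_subspace_eq)
  then show ?thesis
    unfolding tangent_extension_def
    using smooth_on_extension open_U assms(2) D\<Psi>_D\<Phi>[OF assms(2)] by (auto simp: extension_def)
qed

lemma has_derivative_extension:
  "q \<in> U \<Longrightarrow> (extension p v has_derivative frechet_derivative (extension p v) (at q)) (at q)"
  by (rule smooth_on_has_derivative[OF smooth_on_extension])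

text \<open>\<open>SOME\<close> may pick any extension. Along a curve in \<open>S\<close> with
  velocity \<open>u\<close>, its difference from \<open>extension p v\<close> is tangent and
  vanishes at \<open>p\<close>, so the derivative of the difference is tangent and drops out against
  \<open>n\<close>.\<close>

lemma second_fundamental_form_eq:
  assumes p: "p \<in> S" "p \<in> U" and u: "u \<in> tangent_subspace S p" and v: "v \<in> tangent_subspace S p"
    and n: "n \<in> normal_subspace S p"
  shows "second_fundamental_form S p u v \<bullet> n = frechet_derivative (extension p v) (at p) u \<bullet> n"
proof -
  let ?Y = "SOME Y. tangent_extension S p v Y"
  let ?z = "frechet_derivative ?Y (at p) u - frechet_derivative (extension p v) (at p) u"
  have ext: "tangent_extension S p v (extension p v)"
    by (rule tangent_extension_extension[OF p v])
  then have "tangent_extension S p v ?Y" by (rule someI[of "tangent_extension S p v"])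
  then obtain W where Y: "?Y p = v" "open W" "p \<in> W" "smooth_on W ?Y"
      "\<And>q. q \<in> S \<Longrightarrow> q \<in> W \<Longrightarrow> ?Y q \<in> tangent_subspace S q"
    unfolding tangent_extension_def by blast
  obtain \<epsilon> \<gamma> where g: "\<epsilon> > 0" "\<gamma> ` {-\<epsilon><..<\<epsilon>} \<subseteq> S" "\<gamma> 0 = p" "(\<gamma> has_vector_derivative u) (at 0)"
    using u unfolding tangent_subspace_def by blast
  have cont: "isCont \<gamma> 0" using has_vector_derivative_continuous[OF g(4)] .
  have "?z \<in> tangent_subspace S p"
  proof (rule tangent_derivative[OF p cont g(3)])
    show "?Y (\<gamma> 0) - extension p v (\<gamma> 0) = 0"
      using Y(1) g(3) ext by (simp add: tangent_extension_def)
    have "((?Y \<circ> \<gamma>) has_vector_derivative frechet_derivative ?Y (at p) u) (at 0)"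
      by (rule vector_derivative_diff_chain_within[OF g(4)])
        (use g(3) smooth_on_has_derivative[OF Y(4,3)] in \<open>auto intro: has_derivative_at_withinI\<close>)
    moreover have "((extension p v \<circ> \<gamma>) has_vector_derivative frechet_derivative (extension p v) (at p) u) (at 0)"
      by (rule vector_derivative_diff_chain_within[OF g(4)])
        (use g(3) has_derivative_extension[OF p(2)] in \<open>auto intro: has_derivative_at_withinI\<close>)
    ultimately show "((\<lambda>s. ?Y (\<gamma> s) - extension p v (\<gamma> s)) has_vector_derivative ?z) (at 0)"
      using has_vector_derivative_diff by (fastforce simp: comp_def)
    have "\<forall>\<^sub>F s in at 0. \<gamma> s \<in> W \<inter> U"
      using cont g(3) Y(2,3) p(2) open_U by (intro topological_tendstoD[of \<gamma> p]) (auto simp: isCont_def)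
    moreover have "\<forall>\<^sub>F s in at 0. s \<in> {-\<epsilon><..<\<epsilon>}"
      using g(1) by (intro eventually_at_in_open') auto
    ultimately show "\<forall>\<^sub>F s in at 0. \<gamma> s \<in> S \<and> ?Y (\<gamma> s) - extension p v (\<gamma> s) \<in> tangent_subspace S (\<gamma> s)"
    proof eventually_elim
      case (elim s)
      then have s: "\<gamma> s \<in> S" "\<gamma> s \<in> W" "\<gamma> s \<in> U" using g(2) by auto
      have "extension p v (\<gamma> s) \<in> tangent_subspace S (\<gamma> s)"
        using v p D\<Phi>_D\<Psi>[OF \<Phi>_in[OF s(3)]] \<Psi>_\<Phi>[OF s(3)] s
        by (simp add: extension_def tangent_subspace_eq)
      then show ?case
        using Y(5)[OF s(1,2)] s subspace_tangent_subspace by (simp add: subspace_diff)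
    qed
  qed
  then have "?z \<bullet> n = 0"
    using n by (auto simp: normal_subspace_def orthogonal_comp_def orthogonal_def)
  moreover have "second_fundamental_form S p u v \<bullet> n = frechet_derivative ?Y (at p) u \<bullet> n"
    unfolding second_fundamental_form_def
    using n by (intro orthogonal_projection_inner) (auto simp: normal_subspace_def subspace_orthogonal_comp)
  ultimately show ?thesis by (simp add: inner_diff_left)
qed

text \<open>At every point of \<open>U\<close> the field depends linearly on \<open>v\<close>, and
  differentiation preserves this. It is one half of the bilinearity on which basis independence of
  the trace rests.\<close>

lemma linear_frechet_derivative_extension:
  assumes "p \<in> U"
  shows "linear (\<lambda>v. frechet_derivative (extension p v) (at p) u)"
proof -
  have lin: "linear (D\<Phi> p)" "\<And>q. q \<in> U \<Longrightarrow> linear (D\<Psi> (\<Phi> q))"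
    using assms by (auto intro: linear_D\<Phi> linear_D\<Psi> \<Phi>_in)
  show ?thesis
  proof (rule linearI)
    fix v w c
    have "((\<lambda>q. extension p v q + extension p w q) has_derivative
        (\<lambda>u. frechet_derivative (extension p v) (at p) u + frechet_derivative (extension p w) (at p) u)) (at p)"
      by (intro has_derivative_add has_derivative_extension assms)
    then have "(extension p (v + w) has_derivative
        (\<lambda>u. frechet_derivative (extension p v) (at p) u + frechet_derivative (extension p w) (at p) u)) (at p)"
      by (rule has_derivative_transform_within_open[OF _ open_U assms])
        (simp add: extension_def linear_add lin)
    then show "frechet_derivative (extension p (v + w)) (at p) u =
        frechet_derivative (extension p v) (at p) u + frechet_derivative (extension p w) (at p) u"
      by (simp add: frechet_derivative_eqI)
    have "((\<lambda>q. c *\<^sub>R extension p v q) has_derivative (\<lambda>u. c *\<^sub>R frechet_derivative (extension p v) (at p) u)) (at p)"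
      by (intro has_derivative_scaleR_right has_derivative_extension assms)
    then have "(extension p (c *\<^sub>R v) has_derivative (\<lambda>u. c *\<^sub>R frechet_derivative (extension p v) (at p) u)) (at p)"
      by (rule has_derivative_transform_within_open[OF _ open_U assms])
        (simp add: extension_def linear_scale lin)
    then show "frechet_derivative (extension p (c *\<^sub>R v)) (at p) u = c *\<^sub>R frechet_derivative (extension p v) (at p) u"
      by (simp add: frechet_derivative_eqI)
  qed
qed

text \<open>The pulled-back segment is an integral curve of \<open>extension p v\<close>, so its
  acceleration is the derivative of that field along itself.\<close>

lemma curve_acceleration:
  assumes p: "p \<in> S" "p \<in> U" and v: "v \<in> tangent_subspace S p"
  shows "\<exists>\<epsilon>>0. \<exists>\<gamma> \<gamma>'. \<gamma> 0 = p \<and> \<gamma>' 0 = v \<and>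
    (\<forall>s\<in>{-\<epsilon><..<\<epsilon>}. \<gamma> s \<in> S \<and> (\<gamma> has_vector_derivative \<gamma>' s) (at s)) \<and>
    (\<gamma>' has_vector_derivative frechet_derivative (extension p v) (at p) v) (at 0)"
proof -
  have "p \<in> S \<inter> U" "D\<Phi> p v \<in> L" using p v tangent_subspace_eq[OF p] by auto
  then obtain \<epsilon> \<gamma> where g: "\<epsilon> > 0" "smooth_on {-\<epsilon><..<\<epsilon>} \<gamma>" "\<gamma> ` {-\<epsilon><..<\<epsilon>} \<subseteq> S \<inter> U" "\<gamma> 0 = p"
    "\<forall>s\<in>{-\<epsilon><..<\<epsilon>}. (\<gamma> has_vector_derivative extension p v (\<gamma> s)) (at s)"
    unfolding extension_def by (rule tangent_curve) blast
  have v0: "extension p v p = v" using D\<Psi>_D\<Phi>[OF p(2)] by (simp add: extension_def)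
  have d0: "(\<gamma> has_vector_derivative v) (at 0)" using g(1,4) bspec[OF g(5), of 0] v0 by simp
  have "((extension p v \<circ> \<gamma>) has_vector_derivative frechet_derivative (extension p v) (at p) v) (at 0)"
    by (rule vector_derivative_diff_chain_within[OF d0])
      (use g(4) has_derivative_extension[OF p(2)] in \<open>auto intro: has_derivative_at_withinI\<close>)
  then show ?thesis
    using g v0 by (intro exI[of _ \<epsilon>] exI[of _ \<gamma>] exI[of _ "extension p v \<circ> \<gamma>"] conjI) auto
qed

end

section \<open>The trace of the second fundamental form\<close>

lemma orthonormal_basis_of_finite:
  assumes "orthonormal_basis_of W B"
  shows "finite B" "independent B"
proof -
  have "0 \<notin> B" using assms unfolding orthonormal_basis_of_def by force
  then show "independent B"
    using assms pairwise_orthogonal_independent unfolding orthonormal_basis_of_def by blast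
  then show "finite B" using independent_imp_finite by blast
qed

lemma orthonormal_basis_of_card:
  assumes "orthonormal_basis_of W B"
  shows "card B = dim W"
  using assms orthonormal_basis_of_finite[OF assms]
  by (metis dim_span_eq_card_independent orthonormal_basis_of_def)

lemma orthonormal_basis_of_expand:
  assumes "orthonormal_basis_of W B" "v \<in> W"
  shows "(\<Sum>b\<in>B. (v \<bullet> b) *\<^sub>R b) = v"
  using assms orthonormal_basis_of_finite[OF assms(1)]
  by (intro orthonormal_basis_expand) (auto simp: orthonormal_basis_of_def)

lemma orthonormal_basis_of_inner:
  assumes "orthonormal_basis_of W B" "e \<in> B" "f \<in> B"
  shows "e \<bullet> f = (if e = f then 1 else 0)"
  using assms by (auto simp: orthonormal_basis_of_def pairwise_def orthogonal_def dot_square_norm)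

lemma orthonormal_basis_of_exists:
  assumes "subspace W"
  shows "\<exists>B. orthonormal_basis_of W B"
  using orthonormal_basis_subspace[OF assms] unfolding orthonormal_basis_of_def by metis

text \<open>Links the basis chosen by \<open>SOME\<close> in \<open>mean_curvature_vector\<close> to
  the bases used in the second variation. The vectors of \<open>E\<close> are expanded in
  \<open>F\<close>, and the sum over \<open>E\<close> is contracted by Parseval's identity.\<close>

lemma trace_orthonormal_basis_independent:
  fixes q :: "'a::euclidean_space \<Rightarrow> 'a \<Rightarrow> real"
  assumes lin: "\<And>v. linear (\<lambda>u. q u v)" "\<And>u. linear (q u)"
    and E: "orthonormal_basis_of W E" and F: "orthonormal_basis_of W F"
  shows "(\<Sum>e\<in>E. q e e) = (\<Sum>f\<in>F. q f f)"
proof -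
  have EW: "E \<subseteq> W" and FW: "F \<subseteq> W" using E F unfolding orthonormal_basis_of_def by auto
  have "q e e = (\<Sum>f\<in>F. \<Sum>g\<in>F. (e \<bullet> f) * (e \<bullet> g) * q f g)" if "e \<in> E" for e
  proof -
    have ex: "(\<Sum>f\<in>F. (e \<bullet> f) *\<^sub>R f) = e" using orthonormal_basis_of_expand[OF F] EW that by blast
    have "q e e = q (\<Sum>f\<in>F. (e \<bullet> f) *\<^sub>R f) e" by (simp only: ex)
    also have "\<dots> = (\<Sum>f\<in>F. (e \<bullet> f) * q f e)"
      by (subst linear_sum[OF lin(1)]) (simp add: linear_scale[OF lin(1)])
    also have "\<dots> = (\<Sum>f\<in>F. (e \<bullet> f) * q f (\<Sum>g\<in>F. (e \<bullet> g) *\<^sub>R g))" by (simp only: ex)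
    also have "\<dots> = (\<Sum>f\<in>F. \<Sum>g\<in>F. (e \<bullet> f) * (e \<bullet> g) * q f g)"
      by (simp add: linear_sum[OF lin(2)] linear_scale[OF lin(2)] sum_distrib_left mult.assoc)
    finally show ?thesis .
  qed
  then have "(\<Sum>e\<in>E. q e e) = (\<Sum>e\<in>E. \<Sum>f\<in>F. \<Sum>g\<in>F. (e \<bullet> f) * (e \<bullet> g) * q f g)"
    by simp
  also have "\<dots> = (\<Sum>f\<in>F. \<Sum>e\<in>E. \<Sum>g\<in>F. (e \<bullet> f) * (e \<bullet> g) * q f g)"
    by (rule sum.swap)
  also have "\<dots> = (\<Sum>f\<in>F. \<Sum>g\<in>F. \<Sum>e\<in>E. (e \<bullet> f) * (e \<bullet> g) * q f g)"
    by (rule sum.cong[OF refl], rule sum.swap)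
  also have "\<dots> = (\<Sum>f\<in>F. \<Sum>g\<in>F. (f \<bullet> g) * q f g)"
  proof (intro sum.cong refl)
    fix f g assume "f \<in> F" "g \<in> F"
    then have "f \<bullet> g = (\<Sum>e\<in>E. (f \<bullet> e) *\<^sub>R e) \<bullet> g"
      using orthonormal_basis_of_expand[OF E, of f] FW by auto
    then have "f \<bullet> g = (\<Sum>e\<in>E. (e \<bullet> f) * (e \<bullet> g))"
      by (simp add: inner_sum_left inner_sum_right inner_commute)
    then show "(\<Sum>e\<in>E. (e \<bullet> f) * (e \<bullet> g) * q f g) = (f \<bullet> g) * q f g"
      by (simp add: sum_distrib_right)
  qed
  also have "\<dots> = (\<Sum>f\<in>F. q f f)"
  proof (rule sum.cong[OF refl])
    fix f assume "f \<in> F"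
    then have "(\<Sum>g\<in>F. (f \<bullet> g) * q f g) = (\<Sum>g\<in>F. if f = g then q f g else 0)"
      using orthonormal_basis_of_inner[OF F] by (intro sum.cong) auto
    then show "(\<Sum>g\<in>F. (f \<bullet> g) * q f g) = q f f"
      using \<open>f \<in> F\<close> orthonormal_basis_of_finite(1)[OF F] by simp
  qed
  finally show ?thesis .
qed

text \<open>Velocity and acceleration at \<open>p\<close> of a curve in \<open>S\<close>. The
  velocity is an explicit function \<open>\<gamma>'\<close> with differentiability demanded only at
  0, which suffices for the second derivative test.\<close>

definition curve_jet :: "'a::euclidean_space set \<Rightarrow> 'a \<Rightarrow> 'a \<Rightarrow> 'a \<Rightarrow> bool" where
  "curve_jet S p v k \<longleftrightarrow> (\<exists>\<epsilon>>0. \<exists>\<gamma> \<gamma>'. \<gamma> 0 = p \<and> \<gamma>' 0 = v \<and>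
    (\<forall>s\<in>{-\<epsilon><..<\<epsilon>::real}. \<gamma> s \<in> S \<and> (\<gamma> has_vector_derivative \<gamma>' s) (at s)) \<and>
    (\<gamma>' has_vector_derivative k) (at 0))"

text \<open>Lets one point of a pair be held fixed while the other varies.\<close>

lemma curve_jet_const: "p \<in> S \<Longrightarrow> curve_jet S p 0 0"
  unfolding curve_jet_def
  by (rule exI[of _ 1], rule conjI[OF zero_less_one], rule exI[of _ "\<lambda>_. p"], rule exI[of _ "\<lambda>_. 0"]) auto

text \<open>The acceleration of the integral curve with velocity \<open>v\<close> has normal part
  \<open>A(v,v)\<close>. Its trace against a normal is therefore that of the mean curvature vector,
  which the shrinker equation turns into \<open>- (p \<bullet> n)\<close>.\<close>

lemma self_shrinker_jets:
  fixes S :: "'a::euclidean_space set"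
  assumes "self_shrinker m S" "p \<in> S"
  obtains k where "subspace (tangent_subspace S p)" "dim (tangent_subspace S p) = m"
    "\<And>v. v \<in> tangent_subspace S p \<Longrightarrow> curve_jet S p v (k v)"
    "\<And>B n. orthonormal_basis_of (tangent_subspace S p) B \<Longrightarrow> n \<in> normal_subspace S p \<Longrightarrow>
       (\<Sum>e\<in>B. k e \<bullet> n) = - (p \<bullet> n)"
proof -
  obtain U V \<Phi> \<Psi> L where "slice_chart S U V \<Phi> \<Psi> L" and U: "p \<in> U" and L: "dim L = m"
    using assms embedded_submanifold_slice_chart unfolding self_shrinker_def by metis
  then interpret slice_chart S U V \<Phi> \<Psi> L by simp
  define q where "q u v = frechet_derivative (extension p v) (at p) u" for u v
  show thesis
  proof (rule that[of "\<lambda>v. q v v"])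
    show sub: "subspace (tangent_subspace S p)"
      by (rule subspace_tangent_subspace[OF assms(2) U])
    show "dim (tangent_subspace S p) = m"
      using dim_tangent_subspace[OF assms(2) U] L by simp
    show "curve_jet S p v (q v v)" if "v \<in> tangent_subspace S p" for v
      using curve_acceleration[OF assms(2) U that] unfolding curve_jet_def q_def .
    fix B n
    assume B: "orthonormal_basis_of (tangent_subspace S p) B" and n: "n \<in> normal_subspace S p"
    let ?B = "SOME B. orthonormal_basis_of (tangent_subspace S p) B"
    have B': "orthonormal_basis_of (tangent_subspace S p) ?B"
      by (rule someI_ex[OF orthonormal_basis_of_exists[OF sub]])
    have "p \<bullet> n = orthogonal_projection (normal_subspace S p) p \<bullet> n"
      using n by (intro orthogonal_projection_inner[symmetric])
        (auto simp: normal_subspace_def subspace_orthogonal_comp)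
    also have "\<dots> = - (mean_curvature_vector S p \<bullet> n)"
      using assms by (simp add: self_shrinker_def)
    also have "mean_curvature_vector S p \<bullet> n = (\<Sum>e\<in>?B. second_fundamental_form S p e e \<bullet> n)"
      by (simp add: mean_curvature_vector_def inner_sum_left)
    also have "\<dots> = (\<Sum>e\<in>?B. q e e \<bullet> n)"
    proof (rule sum.cong[OF refl])
      fix e assume "e \<in> ?B"
      then have "e \<in> tangent_subspace S p" using B' unfolding orthonormal_basis_of_def by blast
      then show "second_fundamental_form S p e e \<bullet> n = q e e \<bullet> n"
        using second_fundamental_form_eq[OF assms(2) U _ _ n] by (simp add: q_def)
    qed
    also have "\<dots> = (\<Sum>e\<in>B. q e e \<bullet> n)"
    proof (rule trace_orthonormal_basis_independent[where q="\<lambda>u v. q u v \<bullet> n", OF _ _ B' B])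
      have n_lin: "linear (\<lambda>x. x \<bullet> n)" by (simp add: bounded_linear.linear bounded_linear_inner_left)
      show "linear (\<lambda>u. q u v \<bullet> n)" for v
        using linear_compose[OF has_derivative_linear[OF has_derivative_extension[OF U, of p v]] n_lin]
        by (simp add: q_def comp_def)
      show "linear (\<lambda>v. q u v \<bullet> n)" for u
        using linear_compose[OF linear_frechet_derivative_extension[OF U, of u] n_lin]
        by (simp add: q_def comp_def)
    qed
    finally show "(\<Sum>e\<in>B. q e e \<bullet> n) = - (p \<bullet> n)" by simp
  qed
qed

section \<open>The two-point maximum principle\<close>

text \<open>Since \<open>f'\<close> is differentiable only at 0, the mean value theorem replaces a
  Taylor expansion: a negative \<open>d\<close> makes \<open>f'\<close> negative just to the right
  of 0 and pushes \<open>f\<close> below \<open>f 0\<close>.\<close>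

lemma second_derivative_test:
  fixes f f' :: "real \<Rightarrow> real"
  assumes "\<epsilon> > 0" "\<And>s. \<bar>s\<bar> < \<epsilon> \<Longrightarrow> (f has_real_derivative f' s) (at s)"
    and "(f' has_real_derivative d) (at 0)" "\<And>s. \<bar>s\<bar> < \<epsilon> \<Longrightarrow> f 0 \<le> f s"
  shows "f' 0 = 0" "0 \<le> d"
proof -
  show f0: "f' 0 = 0"
    by (rule DERIV_local_min[OF assms(2)[of 0] assms(1)]) (use assms in auto)
  show "0 \<le> d"
  proof (rule ccontr)
    assume "\<not> 0 \<le> d"
    then obtain \<delta> where \<delta>: "\<delta> > 0" "\<And>h. 0 < h \<Longrightarrow> h < \<delta> \<Longrightarrow> f' h < 0"
      using DERIV_neg_dec_right[OF assms(3)] f0 by auto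
    define h where "h = min \<delta> \<epsilon> / 2"
    have h: "0 < h" "h < \<delta>" "h < \<epsilon>" using \<delta>(1) assms(1) by (auto simp: h_def min_def)
    obtain z where "0 < z" "z < h" "f h - f 0 = (h - 0) * f' z"
      using MVT2[of 0 h f f'] h assms(2) by auto
    moreover have "f' z < 0" using \<delta>(2) calculation h by auto
    moreover have "h * f' z < 0" using calculation h by (simp add: mult_pos_neg)
    ultimately have "f h < f 0" by simp
    then show False using assms(4)[of h] h by auto
  qed
qed

section \<open>The two-point function and its variations\<close>

lemma has_real_derivative_inner:
  assumes "(g has_vector_derivative g') (at s)" "(h has_vector_derivative h') (at s)"
  shows "((\<lambda>s. g s \<bullet> h s) has_real_derivative (g' \<bullet> h s + g s \<bullet> h')) (at s)"
proof -
  have "((\<lambda>s. g s \<bullet> h s) has_derivative (\<lambda>t. g s \<bullet> (t *\<^sub>R h') + (t *\<^sub>R g') \<bullet> h s)) (at s)"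
    using assms unfolding has_vector_derivative_def by (rule has_derivative_inner)
  then show ?thesis
    unfolding has_field_derivative_def by (rule has_derivative_eq_rhs) (simp add: fun_eq_iff algebra_simps)
qed

text \<open>Vanishing of \<open>sep \<rho> \<mu> r x y\<close> prescribes the distance of \<open>x\<close> and \<open>y\<close> in the hyperbolic metric of the
  ball of radius \<open>\<surd>r\<close>, which is an increasing function of \<open>|x - y|\<^sup>2 / ((r - |x|\<^sup>2) (r - |y|\<^sup>2))\<close>.\<close>

definition sep :: "real \<Rightarrow> real \<Rightarrow> real \<Rightarrow> 'a::euclidean_space \<Rightarrow> 'a \<Rightarrow> real" where
  "sep \<rho> \<mu> r x y = \<rho> * ((x - y) \<bullet> (x - y)) - \<mu> * (r - x \<bullet> x) * (r - y \<bullet> y)"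

text \<open>The second derivative test is applied to \<open>sep\<close> along a pair of curves. Here
  \<open>a\<close> and \<open>b\<close> are half the gradients of \<open>sep\<close> in the two
  points, and the accelerations enter only through their pairings with them.\<close>

lemma sep_variation:
  fixes x y :: "'a::euclidean_space"
  assumes \<xi>: "curve_jet S\<^sub>1 x \<xi> k" and \<eta>: "curve_jet S\<^sub>2 y \<eta> l"
    and min: "\<delta> > 0" "\<And>x' y'. x' \<in> S\<^sub>1 \<Longrightarrow> y' \<in> S\<^sub>2 \<Longrightarrow> dist x x' < \<delta> \<Longrightarrow> dist y y' < \<delta> \<Longrightarrow>
      sep \<rho> \<mu> r x y \<le> sep \<rho> \<mu> r x' y'"
  defines "a \<equiv> \<rho> *\<^sub>R (x - y) + (\<mu> * (r - y \<bullet> y)) *\<^sub>R x"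
    and "b \<equiv> - \<rho> *\<^sub>R (x - y) + (\<mu> * (r - x \<bullet> x)) *\<^sub>R y"
  shows "a \<bullet> \<xi> + b \<bullet> \<eta> = 0"
    and "0 \<le> \<rho> * ((\<xi> - \<eta>) \<bullet> (\<xi> - \<eta>)) + \<mu> * (r - y \<bullet> y) * (\<xi> \<bullet> \<xi>) + \<mu> * (r - x \<bullet> x) * (\<eta> \<bullet> \<eta>)
      - 4 * \<mu> * (x \<bullet> \<xi>) * (y \<bullet> \<eta>) + k \<bullet> a + l \<bullet> b"
proof -
  obtain \<epsilon>\<^sub>1 \<alpha> \<alpha>' where \<alpha>: "\<epsilon>\<^sub>1 > 0" "\<alpha> 0 = x" "\<alpha>' 0 = \<xi>" "\<And>s. \<bar>s\<bar> < \<epsilon>\<^sub>1 \<Longrightarrow> \<alpha> s \<in> S\<^sub>1"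
    "\<And>s. \<bar>s\<bar> < \<epsilon>\<^sub>1 \<Longrightarrow> (\<alpha> has_vector_derivative \<alpha>' s) (at s)" "(\<alpha>' has_vector_derivative k) (at 0)"
    using \<xi> unfolding curve_jet_def by (auto simp: abs_less_iff)
  obtain \<epsilon>\<^sub>2 \<beta> \<beta>' where \<beta>: "\<epsilon>\<^sub>2 > 0" "\<beta> 0 = y" "\<beta>' 0 = \<eta>" "\<And>s. \<bar>s\<bar> < \<epsilon>\<^sub>2 \<Longrightarrow> \<beta> s \<in> S\<^sub>2"
    "\<And>s. \<bar>s\<bar> < \<epsilon>\<^sub>2 \<Longrightarrow> (\<beta> has_vector_derivative \<beta>' s) (at s)" "(\<beta>' has_vector_derivative l) (at 0)"
    using \<eta> unfolding curve_jet_def by (auto simp: abs_less_iff)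
  have "isCont \<alpha> 0" "isCont \<beta> 0"
    using has_vector_derivative_continuous[OF \<alpha>(5)[of 0]] has_vector_derivative_continuous[OF \<beta>(5)[of 0]]
      \<alpha>(1) \<beta>(1) by simp_all
  then obtain d\<^sub>1 d\<^sub>2 where d: "d\<^sub>1 > 0" "\<And>s. \<bar>s\<bar> < d\<^sub>1 \<Longrightarrow> dist x (\<alpha> s) < \<delta>"
      "d\<^sub>2 > 0" "\<And>s. \<bar>s\<bar> < d\<^sub>2 \<Longrightarrow> dist y (\<beta> s) < \<delta>"
    using min(1) \<alpha>(2) \<beta>(2) unfolding continuous_at_eps_delta
    by (metis dist_commute dist_real_def diff_zero)
  define \<epsilon> where "\<epsilon> = min (min \<epsilon>\<^sub>1 \<epsilon>\<^sub>2) (min d\<^sub>1 d\<^sub>2)"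
  have "\<epsilon> > 0" using \<alpha>(1) \<beta>(1) d by (simp add: \<epsilon>_def)
  define f where "f s = sep \<rho> \<mu> r (\<alpha> s) (\<beta> s)" for s
  \<comment> \<open>\<open>f'\<close> and \<open>d\<close> are the first and second derivatives of
    \<open>f\<close> (the latter at 0); both carry a factor 2 that the claims divide out.\<close>
  define f' where "f' s = 2 * (\<rho> * ((\<alpha> s - \<beta> s) \<bullet> (\<alpha>' s - \<beta>' s)) + \<mu> * (\<alpha> s \<bullet> \<alpha>' s) * (r - \<beta> s \<bullet> \<beta> s)
      + \<mu> * (r - \<alpha> s \<bullet> \<alpha> s) * (\<beta> s \<bullet> \<beta>' s))" for s
  define d where "d = 2 * (\<rho> * ((\<xi> - \<eta>) \<bullet> (\<xi> - \<eta>) + (x - y) \<bullet> (k - l))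
      + \<mu> * (\<xi> \<bullet> \<xi> + x \<bullet> k) * (r - y \<bullet> y) + \<mu> * (r - x \<bullet> x) * (\<eta> \<bullet> \<eta> + y \<bullet> l)
      - 4 * \<mu> * (x \<bullet> \<xi>) * (y \<bullet> \<eta>))"
  have D: "(f has_real_derivative f' s) (at s)" if "\<bar>s\<bar> < \<epsilon>" for s
  proof -
    have A: "(\<alpha> has_vector_derivative \<alpha>' s) (at s)" and B: "(\<beta> has_vector_derivative \<beta>' s) (at s)"
      using that \<alpha>(5) \<beta>(5) by (auto simp: \<epsilon>_def)
    note AB = has_vector_derivative_diff[OF A B]
    note I = has_real_derivative_inner[OF A A] has_real_derivative_inner[OF B B] has_real_derivative_inner[OF AB AB]
    show ?thesis
      unfolding f_def[abs_def] sep_def f'_def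
      by (rule derivative_eq_intros I refl)+ (simp add: algebra_simps inner_commute)
  qed
  have D2: "(f' has_real_derivative d) (at 0)"
  proof -
    have A: "(\<alpha> has_vector_derivative \<xi>) (at 0)" and B: "(\<beta> has_vector_derivative \<eta>) (at 0)"
      using \<alpha>(1,3) \<alpha>(5)[of 0] \<beta>(1,3) \<beta>(5)[of 0] by auto
    note AB = has_vector_derivative_diff[OF A B] has_vector_derivative_diff[OF \<alpha>(6) \<beta>(6)]
    note I = has_real_derivative_inner[OF A A] has_real_derivative_inner[OF B B]
      has_real_derivative_inner[OF A \<alpha>(6)] has_real_derivative_inner[OF B \<beta>(6)] has_real_derivative_inner[OF AB]
    show ?thesis
      unfolding f'_def[abs_def] d_def
      by (rule derivative_eq_intros I refl)+ (simp add: algebra_simps inner_commute \<alpha>(2,3) \<beta>(2,3))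
  qed
  have m: "f 0 \<le> f s" if "\<bar>s\<bar> < \<epsilon>" for s
    unfolding f_def \<alpha>(2) \<beta>(2) using that \<alpha>(4) \<beta>(4) d by (intro min(2)) (auto simp: \<epsilon>_def)
  have "f' 0 = 0" "0 \<le> d"
    using second_derivative_test[OF \<open>\<epsilon> > 0\<close> D D2 m] by auto
  then show "a \<bullet> \<xi> + b \<bullet> \<eta> = 0"
    and "0 \<le> \<rho> * ((\<xi> - \<eta>) \<bullet> (\<xi> - \<eta>)) + \<mu> * (r - y \<bullet> y) * (\<xi> \<bullet> \<xi>) + \<mu> * (r - x \<bullet> x) * (\<eta> \<bullet> \<eta>)
      - 4 * \<mu> * (x \<bullet> \<xi>) * (y \<bullet> \<eta>) + k \<bullet> a + l \<bullet> b"
    unfolding f'_def d_def a_def b_def \<alpha>(2,3) \<beta>(2,3)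
    by (simp_all add: algebra_simps inner_commute)
qed


section \<open>Isometric images of frames and tangent hyperplanes\<close>

lemma orthonormal_basis_of_image:
  assumes "linear g" "\<And>v w. g v \<bullet> g w = v \<bullet> w" "orthonormal_basis_of W B"
  shows "orthonormal_basis_of (g ` W) (g ` B)"
  using assms(3) linear_span_image[OF assms(1), of B]
  by (auto simp: orthonormal_basis_of_def pairwise_def orthogonal_def norm_eq_sqrt_inner assms(2))

lemma normal_subspace_iff: "n \<in> normal_subspace S p \<longleftrightarrow> (\<forall>v\<in>tangent_subspace S p. n \<bullet> v = 0)"
  by (auto simp: normal_subspace_def orthogonal_comp_def orthogonal_def inner_commute)

text \<open>In codimension one a nonzero normal determines the tangent space, by comparison of
  dimensions.\<close>

lemma tangent_subspace_eq_hyperplane: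
  fixes S :: "'a::euclidean_space set"
  assumes "subspace (tangent_subspace S p)" "dim (tangent_subspace S p) = m" "DIM('a) = m + 1"
    and "n \<in> normal_subspace S p" "n \<noteq> 0"
  shows "tangent_subspace S p = {v. n \<bullet> v = 0}"
proof (rule subspace_dim_equal[OF assms(1) subspace_hyperplane])
  show "tangent_subspace S p \<subseteq> {v. n \<bullet> v = 0}" using assms(4) normal_subspace_iff by blast
  show "dim {v. n \<bullet> v = 0} \<le> dim (tangent_subspace S p)"
    using dim_hyperplane[OF assms(5)] assms(2,3) by simp
qed

text \<open>The heart of the proof: at a minimum of \<open>sep\<close>, the tangent spaces at \<open>x\<close> and \<open>y\<close> are exchanged by
  the reflection in the hyperplane orthogonal to \<open>x - y\<close>, which plays the role of parallel transport
  along the hyperbolic geodesic. Summing the second variations along the pairs of directions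
  \<open>(\<xi>, refl \<xi>)\<close> brings in the two mean curvatures, and all other second-order terms that depend on
  \<open>\<xi>\<close> cancel.\<close>

lemma sep_min_bound:
  fixes \<Sigma>\<^sub>1 \<Sigma>\<^sub>2 :: "'a::euclidean_space set"
  assumes shr: "self_shrinker m \<Sigma>\<^sub>1" "self_shrinker m \<Sigma>\<^sub>2"
    and xy: "x \<in> \<Sigma>\<^sub>1" "y \<in> \<Sigma>\<^sub>2" "x \<noteq> y"
    and r: "x \<bullet> x < r" "y \<bullet> y < r" and pos: "\<rho> > 0" "\<mu> > 0"
    and zero: "sep \<rho> \<mu> r x y = 0"
    and min: "\<delta> > 0" "\<And>x' y'. x' \<in> \<Sigma>\<^sub>1 \<Longrightarrow> y' \<in> \<Sigma>\<^sub>2 \<Longrightarrow> dist x x' < \<delta> \<Longrightarrow> dist y y' < \<delta> \<Longrightarrow>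
      sep \<rho> \<mu> r x y \<le> sep \<rho> \<mu> r x' y'"
  shows "\<mu> * (r - m) * ((r - x \<bullet> x) + (r - y \<bullet> y)) \<le> \<rho> * ((x - y) \<bullet> (x - y))"
proof -
  define w where "w = x - y"
  define D where "D = w \<bullet> w"
  define u where "u = r - x \<bullet> x"
  define t where "t = r - y \<bullet> y"
  define a where "a = \<rho> *\<^sub>R w + (\<mu> * t) *\<^sub>R x"
  define b where "b = - \<rho> *\<^sub>R w + (\<mu> * u) *\<^sub>R y"
  define refl where "refl v = v - (2 * (v \<bullet> w) / D) *\<^sub>R w" for v
  have D0: "D > 0" using xy(3) by (simp add: D_def w_def)
  have ut: "u > 0" "t > 0" using r by (simp_all add: u_def t_def)
  have r0: "r > 0" using r(1) inner_ge_zero[of x] by linarith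
  \<comment> \<open>The contact condition; every cancellation below between terms at
    \<open>x\<close> and terms at \<open>y\<close> goes through it.\<close>
  have \<rho>D: "\<rho> * D = \<mu> * u * t"
    using zero by (simp add: sep_def D_def w_def u_def t_def)
  have xw: "2 * (x \<bullet> w) = D + t - u" and yw: "2 * (y \<bullet> w) = t - u - D"
    by (simp_all add: D_def w_def u_def t_def algebra_simps inner_commute)
  have xx: "x \<bullet> x = r - u" and yy: "y \<bullet> y = r - t" by (simp_all add: u_def t_def)
  have y_eq: "y = x - w" by (simp add: w_def)

  obtain k where k: "subspace (tangent_subspace \<Sigma>\<^sub>1 x)" "dim (tangent_subspace \<Sigma>\<^sub>1 x) = m"
    "\<And>v. v \<in> tangent_subspace \<Sigma>\<^sub>1 x \<Longrightarrow> curve_jet \<Sigma>\<^sub>1 x v (k v)"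
    "\<And>B n. orthonormal_basis_of (tangent_subspace \<Sigma>\<^sub>1 x) B \<Longrightarrow> n \<in> normal_subspace \<Sigma>\<^sub>1 x \<Longrightarrow>
       (\<Sum>e\<in>B. k e \<bullet> n) = - (x \<bullet> n)"
    using self_shrinker_jets[OF shr(1) xy(1)] by metis
  obtain l where l: "subspace (tangent_subspace \<Sigma>\<^sub>2 y)" "dim (tangent_subspace \<Sigma>\<^sub>2 y) = m"
    "\<And>v. v \<in> tangent_subspace \<Sigma>\<^sub>2 y \<Longrightarrow> curve_jet \<Sigma>\<^sub>2 y v (l v)"
    "\<And>B n. orthonormal_basis_of (tangent_subspace \<Sigma>\<^sub>2 y) B \<Longrightarrow> n \<in> normal_subspace \<Sigma>\<^sub>2 y \<Longrightarrow>
       (\<Sum>e\<in>B. l e \<bullet> n) = - (y \<bullet> n)"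
    using self_shrinker_jets[OF shr(2) xy(2)] by metis

  \<comment> \<open>Only the first point moves, so the first variation pairs \<open>a\<close> alone
    with the tangent vector.\<close>
  have a_normal: "a \<in> normal_subspace \<Sigma>\<^sub>1 x"
    unfolding normal_subspace_iff
  proof
    fix v assume "v \<in> tangent_subspace \<Sigma>\<^sub>1 x"
    from sep_variation(1)[OF k(3)[OF this] curve_jet_const[OF xy(2)] min]
    show "a \<bullet> v = 0" by (simp add: a_def w_def t_def)
  qed
  have b_normal: "b \<in> normal_subspace \<Sigma>\<^sub>2 y"
    unfolding normal_subspace_iff
  proof
    fix v assume "v \<in> tangent_subspace \<Sigma>\<^sub>2 y"
    from sep_variation(1)[OF curve_jet_const[OF xy(1)] l(3)[OF this] min]
    show "b \<bullet> v = 0" by (simp add: b_def w_def u_def)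
  qed

  have refl_linear: "linear refl"
    by (rule linearI) (auto simp: refl_def algebra_simps inner_add_left add_divide_distrib)
  have refl_inner: "refl v \<bullet> refl v' = v \<bullet> v'" for v v'
  proof -
    have "refl v \<bullet> refl v' = v \<bullet> v' - 2 * (v' \<bullet> w) / D * (v \<bullet> w) - 2 * (v \<bullet> w) / D * (v' \<bullet> w)
        + 2 * (v \<bullet> w) / D * (2 * (v' \<bullet> w) / D) * D"
      by (simp add: refl_def inner_diff_left inner_diff_right inner_commute D_def)
    then show ?thesis using D0 by (simp add: field_simps)
  qed
  have refl_sym: "refl v \<bullet> v' = v \<bullet> refl v'" for v v'
    by (simp add: refl_def inner_diff_left inner_diff_right inner_commute)
  have refl_refl: "refl (refl v) = v" for v
  proof -
    have "refl v \<bullet> w = - (v \<bullet> w)"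
      using D0 by (simp add: refl_def inner_diff_left flip: D_def)
    then show ?thesis by (simp add: refl_def[of "refl v"]) (simp add: refl_def)
  qed
  \<comment> \<open>By the contact condition the reflection carries \<open>a\<close> to a positive
    multiple of \<open>b\<close>; the ratio of \<open>t\<close> to \<open>u\<close> is cleared of
    denominators.\<close>
  have refl_a: "u *\<^sub>R refl a = t *\<^sub>R b"
  proof -
    have "2 * (a \<bullet> w) = 2 * \<rho> * D + \<mu> * t * (2 * (x \<bullet> w))"
      by (simp add: a_def inner_add_left D_def)
    then have "2 * (a \<bullet> w) = 2 * \<rho> * D + \<mu> * t * (D + t - u)" by (simp only: xw)
    then have c: "u * (2 * (a \<bullet> w) / D) = 2 * \<rho> * u + \<mu> * t * u + \<rho> * (t - u)"
      using D0 \<rho>D by (simp add: field_simps) algebra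
    have "u *\<^sub>R refl a = (u * \<rho>) *\<^sub>R w + (u * \<mu> * t) *\<^sub>R x - (u * (2 * (a \<bullet> w) / D)) *\<^sub>R w"
      by (simp add: refl_def a_def algebra_simps)
    also have "\<dots> = t *\<^sub>R b"
      unfolding c b_def y_eq by (simp add: algebra_simps)
    finally show ?thesis .
  qed
  have refl_b: "t *\<^sub>R refl b = u *\<^sub>R a"
    using arg_cong[OF refl_a, of refl] by (simp add: linear_scale[OF refl_linear] refl_refl)
  \<comment> \<open>The contact condition reduces \<open>a \<bullet> a\<close> to a sum of positive
    terms, so \<open>a\<close> is a nonzero normal and determines the tangent hyperplane.\<close>
  have "a \<bullet> a = \<rho> * (\<rho> * D) + \<rho> * \<mu> * t * (2 * (x \<bullet> w)) + \<mu>\<^sup>2 * t\<^sup>2 * (x \<bullet> x)"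
    by (simp add: a_def D_def inner_add_left inner_add_right inner_commute algebra_simps power2_eq_square)
  also have "\<dots> = \<rho> * \<mu> * t\<^sup>2 + \<mu>\<^sup>2 * t\<^sup>2 * r"
    unfolding xw xx using \<rho>D by algebra
  also have "\<dots> > 0" using pos ut r0 by (intro add_pos_pos mult_pos_pos) auto
  finally have a0: "a \<noteq> 0" by auto
  then have b0: "b \<noteq> 0" using refl_b ut linear_0[OF refl_linear] by auto

  have DIM: "DIM('a) = m + 1" using shr(1) by (simp add: self_shrinker_def)
  note T1 = tangent_subspace_eq_hyperplane[OF k(1,2) DIM a_normal a0]
  note T2 = tangent_subspace_eq_hyperplane[OF l(1,2) DIM b_normal b0]
  have T12: "refl ` tangent_subspace \<Sigma>\<^sub>1 x = tangent_subspace \<Sigma>\<^sub>2 y"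
  proof -
    have eq: "t * (b \<bullet> refl v) = u * (a \<bullet> v)" for v
      using arg_cong[OF refl_b, of "\<lambda>z. z \<bullet> v"] refl_sym[of b v] by simp
    have fwd: "b \<bullet> refl v = 0 \<longleftrightarrow> a \<bullet> v = 0" for v
      using eq[of v] ut by (metis mult_eq_0_iff less_numeral_extra(3))
    show ?thesis
    proof (intro equalityI subsetI)
      fix v assume "v \<in> refl ` tangent_subspace \<Sigma>\<^sub>1 x"
      then show "v \<in> tangent_subspace \<Sigma>\<^sub>2 y" unfolding T1 T2 using fwd by auto
    next
      fix v assume "v \<in> tangent_subspace \<Sigma>\<^sub>2 y"
      then have "refl v \<in> tangent_subspace \<Sigma>\<^sub>1 x" unfolding T1 T2 using fwd[of "refl v"] refl_refl by simp
      then have "refl (refl v) \<in> refl ` tangent_subspace \<Sigma>\<^sub>1 x" by (rule imageI)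
      then show "v \<in> refl ` tangent_subspace \<Sigma>\<^sub>1 x" by (simp only: refl_refl)
    qed
  qed

  obtain B where B: "orthonormal_basis_of (tangent_subspace \<Sigma>\<^sub>1 x) B"
    using orthonormal_basis_of_exists[OF k(1)] by blast
  have B': "orthonormal_basis_of (tangent_subspace \<Sigma>\<^sub>2 y) (refl ` B)"
    using orthonormal_basis_of_image[OF refl_linear refl_inner B] T12 by simp
  have "0 \<le> \<mu> * (u + t) + k e \<bullet> a + l (refl e) \<bullet> b" if e: "e \<in> B" for e
  proof -
    have e1: "e \<in> tangent_subspace \<Sigma>\<^sub>1 x" and e2: "refl e \<in> tangent_subspace \<Sigma>\<^sub>2 y"
      using B B' e unfolding orthonormal_basis_of_def by auto
    have ee: "e \<bullet> e = 1" "refl e \<bullet> refl e = 1"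
      using orthonormal_basis_of_inner[OF B e e] refl_inner by auto
    have V: "0 \<le> \<rho> * ((e - refl e) \<bullet> (e - refl e)) + \<mu> * t + \<mu> * u
        - 4 * \<mu> * (x \<bullet> e) * (y \<bullet> refl e) + k e \<bullet> a + l (refl e) \<bullet> b"
      using sep_variation(2)[OF k(3)[OF e1] l(3)[OF e2] min]
      by (simp add: ee w_def u_def t_def a_def b_def)
    have "e - refl e = (2 * (e \<bullet> w) / D) *\<^sub>R w" by (simp add: refl_def)
    then have "(e - refl e) \<bullet> (e - refl e) = (2 * (e \<bullet> w) / D)\<^sup>2 * D"
      by (simp add: D_def power2_eq_square)
    then have first: "\<rho> * ((e - refl e) \<bullet> (e - refl e)) = 4 * \<rho> * (e \<bullet> w)\<^sup>2 / D"
      using D0 by (simp add: power2_eq_square field_simps)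
    \<comment> \<open>Tangency of \<open>e\<close> and of \<open>refl e\<close> expresses
      \<open>x \<bullet> e\<close> and \<open>y \<bullet> refl e\<close> through
      \<open>e \<bullet> w\<close>. By the contact condition the mixed term then cancels the term
      computed in \<open>first\<close>.\<close>
    have "a \<bullet> e = 0" using e1 T1 by blast
    then have p: "\<mu> * t * (x \<bullet> e) = - \<rho> * (e \<bullet> w)"
      unfolding a_def inner_add_left inner_scaleR_left inner_commute[of w e] by linarith
    have "refl e \<bullet> w = - (e \<bullet> w)"
      using D0 by (simp add: refl_def inner_diff_left flip: D_def)
    moreover have "b \<bullet> refl e = 0" using e2 T2 by blast
    ultimately have q: "\<mu> * u * (y \<bullet> refl e) = - \<rho> * (e \<bullet> w)"
      unfolding b_def inner_add_left inner_scaleR_left inner_commute[of w "refl e"] by simp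
    have "(\<mu> * (x \<bullet> e) * (y \<bullet> refl e)) * (\<mu> * u * t) = \<rho>\<^sup>2 * (e \<bullet> w)\<^sup>2"
      using p q by algebra
    then have "\<rho> * ((\<mu> * (x \<bullet> e) * (y \<bullet> refl e)) * D) = \<rho> * (\<rho> * (e \<bullet> w)\<^sup>2)"
      unfolding \<rho>D[symmetric] by (simp add: power2_eq_square algebra_simps)
    then have "\<mu> * (x \<bullet> e) * (y \<bullet> refl e) = \<rho> * (e \<bullet> w)\<^sup>2 / D"
      using pos(1) D0 by (simp add: field_simps)
    then have "4 * \<mu> * (x \<bullet> e) * (y \<bullet> refl e) = 4 * \<rho> * (e \<bullet> w)\<^sup>2 / D" by simp
    then show ?thesis using V first by (simp add: algebra_simps)
  qed
  then have "0 \<le> (\<Sum>e\<in>B. \<mu> * (u + t) + k e \<bullet> a + l (refl e) \<bullet> b)"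
    by (rule sum_nonneg)
  also have "\<dots> = m * (\<mu> * (u + t)) + (\<Sum>e\<in>B. k e \<bullet> a) + (\<Sum>e\<in>B. l (refl e) \<bullet> b)"
    using orthonormal_basis_of_card[OF B] k(2) by (simp add: sum.distrib)
  also have "(\<Sum>e\<in>B. l (refl e) \<bullet> b) = (\<Sum>e\<in>refl ` B. l e \<bullet> b)"
    by (subst sum.reindex) (auto intro: inj_on_inverseI[of _ refl] simp: refl_refl)
  also have "m * (\<mu> * (u + t)) + (\<Sum>e\<in>B. k e \<bullet> a) + (\<Sum>e\<in>refl ` B. l e \<bullet> b)
      = m * (\<mu> * (u + t)) - x \<bullet> a - y \<bullet> b"
    using k(4)[OF B a_normal] l(4)[OF B' b_normal] by simp
  \<comment> \<open>As \<open>\<mu> * u * t = \<rho> * D\<close>, the two pairings add up to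
    \<open>\<mu> * r * (u + t) - \<rho> * D\<close>.\<close>
  also have "x \<bullet> a = \<rho> * (x \<bullet> w) + \<mu> * t * (r - u)"
    by (simp add: a_def inner_add_right xx)
  also have "y \<bullet> b = - \<rho> * (y \<bullet> w) + \<mu> * u * (r - t)"
    by (simp add: b_def inner_diff_right inner_add_right yy)
  finally have "0 \<le> m * (\<mu> * (u + t)) - (\<rho> * (x \<bullet> w - y \<bullet> w) + \<mu> * r * (u + t) - 2 * (\<mu> * u * t))"
    by (simp add: algebra_simps)
  moreover have "x \<bullet> w - y \<bullet> w = D" by (simp add: D_def w_def inner_diff_left)
  ultimately show ?thesis
    unfolding \<rho>D[symmetric] by (simp add: algebra_simps flip: w_def D_def u_def t_def)
qed

section \<open>Avoidance\<close>

lemma continuous_on_sep: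
  "continuous_on UNIV (\<lambda>(x::'a::euclidean_space, y, s). sep (s - c) \<mu> s x y)"
  unfolding sep_def case_prod_unfold by (intro continuous_intros)

text \<open>At the first contact two estimates collide: minimality in the points, through the
  shrinker equations, bounds \<open>|x - y|^2\<close> from below, while positivity at earlier
  parameters bounds it from above.\<close>

lemma frankel_self_shrinkers:
  fixes \<Sigma>\<^sub>1 \<Sigma>\<^sub>2 :: "'a::euclidean_space set"
  assumes shr: "self_shrinker m \<Sigma>\<^sub>1" "self_shrinker m \<Sigma>\<^sub>2"
    and prp: "properly_embedded \<Sigma>\<^sub>1" "properly_embedded \<Sigma>\<^sub>2"
  shows "\<Sigma>\<^sub>1 \<inter> \<Sigma>\<^sub>2 \<noteq> {}"
proof
  assume disj: "\<Sigma>\<^sub>1 \<inter> \<Sigma>\<^sub>2 = {}"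
  obtain x0 y0 where xy0: "x0 \<in> \<Sigma>\<^sub>1" "y0 \<in> \<Sigma>\<^sub>2"
    using shr unfolding self_shrinker_def by blast
  define c :: real where "c = m + 1"
  have c: "c > 0" by (simp add: c_def)
  \<comment> \<open>Large enough that \<open>r0 - c\<close> is positive and that both base points
    lie inside the ball of radius \<open>sqrt r0\<close>.\<close>
  define r0 where "r0 = c + 1 + x0 \<bullet> x0 + y0 \<bullet> y0"
  have r0: "r0 > c" "r0 > 0" "x0 \<bullet> x0 < r0" "y0 \<bullet> y0 < r0"
    using inner_ge_zero[of x0] inner_ge_zero[of y0] c unfolding r0_def by linarith+
  have compact: "compact (\<Sigma>\<^sub>1 \<inter> cball 0 (sqrt r))" "compact (\<Sigma>\<^sub>2 \<inter> cball 0 (sqrt r))" for r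
    using prp compact_cball unfolding properly_embedded_def by blast+
  have cball: "z \<in> cball 0 (sqrt r) \<longleftrightarrow> z \<bullet> z \<le> r" for z :: 'a and r
    by (simp add: norm_eq_sqrt_inner)

  \<comment> \<open>Properness makes the parts of the surfaces in the ball compact, so their squared
    distance is attained; disjointness makes it positive.\<close>
  obtain d where d: "d > 0" "\<And>x y. x \<in> \<Sigma>\<^sub>1 \<Longrightarrow> y \<in> \<Sigma>\<^sub>2 \<Longrightarrow> x \<bullet> x \<le> r0 \<Longrightarrow> y \<bullet> y \<le> r0 \<Longrightarrow> d \<le> (x - y) \<bullet> (x - y)"
  proof -
    let ?C = "(\<Sigma>\<^sub>1 \<inter> cball 0 (sqrt r0)) \<times> (\<Sigma>\<^sub>2 \<inter> cball 0 (sqrt r0))"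
    let ?f = "\<lambda>z. (fst z - snd z) \<bullet> (fst z - snd z) :: real"
    have "(x0, y0) \<in> ?C" using xy0 r0 cball by simp
    then have "\<exists>z\<in>?C. \<forall>z'\<in>?C. ?f z \<le> ?f z'"
      by (intro continuous_attains_inf compact_Times compact continuous_intros) blast
    then obtain x y where z: "x \<in> \<Sigma>\<^sub>1" "y \<in> \<Sigma>\<^sub>2" "\<forall>z'\<in>?C. ?f (x, y) \<le> ?f z'"
      by blast
    have "x \<noteq> y" using z disj by auto
    show thesis
    proof (rule that)
      show "0 < (x - y) \<bullet> (x - y)" using \<open>x \<noteq> y\<close> by simp
      fix x' y' assume "x' \<in> \<Sigma>\<^sub>1" "y' \<in> \<Sigma>\<^sub>2" "x' \<bullet> x' \<le> r0" "y' \<bullet> y' \<le> r0"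
      then have "(x', y') \<in> ?C" using cball by simp
      then show "(x - y) \<bullet> (x - y) \<le> (x' - y') \<bullet> (x' - y')" using z(3) by fastforce
    qed
  qed
  \<comment> \<open>Chosen so that \<open>\<mu> * r0\<^sup>2\<close> is half of
    \<open>(r0 - c) * d\<close>: the product subtracted in \<open>sep\<close> is at most
    \<open>\<mu> * r0\<^sup>2\<close>, so \<open>sep\<close> starts positive.\<close>
  define \<mu> where "\<mu> = (r0 - c) * d / (2 * r0\<^sup>2)"
  have \<mu>: "\<mu> > 0" using r0 d(1) by (simp add: \<mu>_def)
  have start: "sep (r0 - c) \<mu> r0 x y > 0"
    if "x \<in> \<Sigma>\<^sub>1" "y \<in> \<Sigma>\<^sub>2" "x \<bullet> x \<le> r0" "y \<bullet> y \<le> r0" for x y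
  proof -
    have "(r0 - x \<bullet> x) * (r0 - y \<bullet> y) \<le> r0 * r0"
      using that r0(2) by (intro mult_mono) auto
    then have "\<mu> * ((r0 - x \<bullet> x) * (r0 - y \<bullet> y)) \<le> \<mu> * (r0 * r0)"
      using \<mu> by (intro mult_left_mono) auto
    also have "\<dots> < (r0 - c) * d"
      using r0 d(1) by (simp add: \<mu>_def power2_eq_square)
    also have "\<dots> \<le> (r0 - c) * ((x - y) \<bullet> (x - y))"
      using d(2)[OF that] r0(1) by (intro mult_left_mono) auto
    finally show ?thesis by (simp add: sep_def mult.assoc)
  qed

  define A where "A = (x0 - y0) \<bullet> (x0 - y0)"
  \<comment> \<open>In \<open>sep\<close> at the base points the distance term grows linearly in the
    parameter and the product quadratically. The bounds \<open>t \<ge> r0\<close> and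
    \<open>\<mu> * t > 2 * A\<close> make the product win at \<open>r1 = r0 + t\<close>.\<close>
  define t where "t = r0 + 2 * A / \<mu> + 1"
  have A: "A \<ge> 0" by (simp add: A_def)
  have t: "t \<ge> r0" "t > 0" "\<mu> * t > 2 * A"
  proof -
    have "2 * A / \<mu> \<ge> 0" using A \<mu> by simp
    then show "t \<ge> r0" "t > 0" using r0(2) by (simp_all add: t_def)
    have "\<mu> * t = \<mu> * r0 + 2 * A + \<mu>" using \<mu> by (simp add: t_def field_simps)
    then show "\<mu> * t > 2 * A" using mult_pos_pos[OF \<mu> r0(2)] \<mu> by linarith
  qed
  define r1 where "r1 = r0 + t"
  have "sep (r1 - c) \<mu> r1 x0 y0 \<le> 0"
  proof -
    have "(r1 - c) * A \<le> 2 * t * A"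
      using A t(1) c by (intro mult_right_mono) (auto simp: r1_def)
    also have "\<dots> \<le> \<mu> * t * t" using t by (simp add: mult.commute mult_left_mono)
    also have "\<dots> = \<mu> * (t * t)" by simp
    also have "\<dots> \<le> \<mu> * ((r1 - x0 \<bullet> x0) * (r1 - y0 \<bullet> y0))"
      using \<mu> t r0 by (intro mult_left_mono mult_mono) (auto simp: r1_def)
    finally show ?thesis by (simp add: sep_def A_def mult.assoc)
  qed
  \<comment> \<open>All failures of positivity, with closed conditions so that the set is compact. A
    point of \<open>G\<close> with least parameter is the first contact.\<close>
  define G where "G = {(x, y, s). x \<in> \<Sigma>\<^sub>1 \<and> y \<in> \<Sigma>\<^sub>2 \<and> x \<bullet> x \<le> s \<and> y \<bullet> y \<le> s \<and> r0 \<le> s \<and> s \<le> r1 \<and>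
    sep (s - c) \<mu> s x y \<le> 0}"
  have "(x0, y0, r1) \<in> G"
    using xy0 r0 t \<open>sep (r1 - c) \<mu> r1 x0 y0 \<le> 0\<close> by (auto simp: G_def r1_def)
  moreover have "compact G"
  proof -
    let ?K = "(\<Sigma>\<^sub>1 \<inter> cball 0 (sqrt r1)) \<times> (\<Sigma>\<^sub>2 \<inter> cball 0 (sqrt r1)) \<times> {r0..r1}"
    let ?F = "{z. fst z \<bullet> fst z \<le> snd (snd z)} \<inter> {z. fst (snd z) \<bullet> fst (snd z) \<le> snd (snd z)}
      \<inter> {z. (\<lambda>(x, y, s). sep (s - c) \<mu> s x y) z \<le> 0}"
    have "compact (?K \<inter> ?F)"
      by (intro compact_Int_closed closed_Int closed_Collect_le compact_Times compact compact_Icc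
          continuous_on_sep continuous_intros)
    moreover have "G = ?K \<inter> ?F"
      unfolding G_def by (auto simp: cball simp del: mem_cball mem_cball_0)
    ultimately show ?thesis by simp
  qed
  ultimately have "\<exists>z\<in>G. \<forall>z'\<in>G. snd (snd z) \<le> snd (snd z')"
    by (intro continuous_attains_inf continuous_intros) auto
  then obtain x y r where G: "(x, y, r) \<in> G" and min: "\<forall>z'\<in>G. r \<le> snd (snd z')"
    by auto
  then have first: "r \<le> r'" if "(x', y', r') \<in> G" for x' y' r'
    using bspec[OF min that] by simp
  have xy: "x \<in> \<Sigma>\<^sub>1" "y \<in> \<Sigma>\<^sub>2" and le: "x \<bullet> x \<le> r" "y \<bullet> y \<le> r" "r0 \<le> r" "r \<le> r1"
    and sep_le: "sep (r - c) \<mu> r x y \<le> 0"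
    using G by (auto simp: G_def)
  have before: "sep (s - c) \<mu> s x' y' > 0"
    if "x' \<in> \<Sigma>\<^sub>1" "y' \<in> \<Sigma>\<^sub>2" "x' \<bullet> x' \<le> s" "y' \<bullet> y' \<le> s" "r0 \<le> s" "s < r" for x' y' s
    using first[of x' y' s] that le(4) by (force simp: G_def)
  have "r \<noteq> r0" using start xy le sep_le by force
  then have "r0 < r" using le by simp
  have "x \<noteq> y" using xy disj by auto
  then have D0: "(x - y) \<bullet> (x - y) > 0" by simp
  have rc: "r - c > 0" using r0(1) le(3) by simp
  \<comment> \<open>Contact cannot occur on the boundary sphere: there the product vanishes and
    \<open>sep\<close> is positive.\<close>
  have "x \<bullet> x \<noteq> r" "y \<bullet> y \<noteq> r"
    using sep_le mult_pos_pos[OF rc D0] by (auto simp: sep_def)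
  then have lt: "x \<bullet> x < r" "y \<bullet> y < r" using le by auto

  \<comment> \<open>A pair in the open ball also lies in slightly smaller balls, where
    \<open>sep\<close> is positive; let the parameter increase to \<open>r\<close>.\<close>
  have nonneg: "0 \<le> sep (r - c) \<mu> r x' y'"
    if "x' \<in> \<Sigma>\<^sub>1" "y' \<in> \<Sigma>\<^sub>2" "x' \<bullet> x' < r" "y' \<bullet> y' < r" for x' y'
  proof (rule tendsto_lowerbound)
    show "((\<lambda>s. sep (s - c) \<mu> s x' y') \<longlongrightarrow> sep (r - c) \<mu> r x' y') (at_left r)"
      unfolding sep_def by (intro tendsto_intros)
    have "\<forall>\<^sub>F s in at_left r. s \<in> {max r0 (max (x' \<bullet> x') (y' \<bullet> y'))<..<r}"
      using that(3,4) \<open>r0 < r\<close> by (intro eventually_at_left_real) auto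
    then show "\<forall>\<^sub>F s in at_left r. 0 \<le> sep (s - c) \<mu> s x' y'"
      by eventually_elim (use before that(1,2) in \<open>auto intro!: less_imp_le\<close>)
  qed simp
  have sep0: "sep (r - c) \<mu> r x y = 0" using nonneg[OF xy lt] sep_le by simp

  \<comment> \<open>Keeps the competing points in the open ball, where \<open>nonneg\<close> makes
    the value 0 at \<open>(x, y)\<close> a local minimum.\<close>
  obtain \<delta> where \<delta>: "\<delta> > 0" "ball x \<delta> \<subseteq> {z. z \<bullet> z < r}" "ball y \<delta> \<subseteq> {z. z \<bullet> z < r}"
  proof -
    have "open {z::'a. z \<bullet> z < r}" by (intro open_Collect_less continuous_intros)
    then obtain d1 d2 where "d1 > 0" "ball x d1 \<subseteq> {z. z \<bullet> z < r}" "d2 > 0" "ball y d2 \<subseteq> {z. z \<bullet> z < r}"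
      using lt unfolding open_contains_ball by blast
    then show thesis using that[of "min d1 d2"] by (auto simp: subset_iff)
  qed
  have "\<mu> * (r - m) * ((r - x \<bullet> x) + (r - y \<bullet> y)) \<le> (r - c) * ((x - y) \<bullet> (x - y))"
  proof (rule sep_min_bound[OF shr xy \<open>x \<noteq> y\<close> lt rc \<mu> sep0 \<delta>(1)])
    fix x' y' assume "x' \<in> \<Sigma>\<^sub>1" "y' \<in> \<Sigma>\<^sub>2" "dist x x' < \<delta>" "dist y y' < \<delta>"
    then show "sep (r - c) \<mu> r x y \<le> sep (r - c) \<mu> r x' y'"
      unfolding sep0 using \<delta>(2,3) by (intro nonneg) auto
  qed
  \<comment> \<open>\<open>sep\<close> drops from a positive value at the earlier parameter
    \<open>s\<close> to 0 at \<open>r\<close>. It is quadratic in the parameter, so the difference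
    is computed exactly, and its term \<open>\<mu> * (r - s)\<close> makes the bound strict.\<close>
  moreover have "(x - y) \<bullet> (x - y) < \<mu> * ((r - x \<bullet> x) + (r - y \<bullet> y))"
  proof -
    define s where "s = max r0 (max (x \<bullet> x) (y \<bullet> y))"
    have s: "s < r" using lt \<open>r0 < r\<close> by (simp add: s_def)
    have "0 < sep (s - c) \<mu> s x y - sep (r - c) \<mu> r x y"
      using before[OF xy _ _ _ s] sep0 by (simp add: s_def)
    also have "\<dots> = (r - s) * (\<mu> * ((r - x \<bullet> x) + (r - y \<bullet> y)) - (x - y) \<bullet> (x - y) - \<mu> * (r - s))"
      by (simp add: sep_def algebra_simps)
    finally have "\<mu> * (r - s) < \<mu> * ((r - x \<bullet> x) + (r - y \<bullet> y)) - (x - y) \<bullet> (x - y)"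
      using s by (simp add: zero_less_mult_iff)
    moreover have "0 < \<mu> * (r - s)" using s \<mu> by simp
    ultimately show ?thesis by linarith
  qed
  \<comment> \<open>Chaining both bounds forces \<open>r - m < r - c\<close> after division by a
    positive factor, against \<open>c = m + 1\<close>.\<close>
  ultimately have "(r - m) * (\<mu> * ((r - x \<bullet> x) + (r - y \<bullet> y))) < (r - c) * (\<mu> * ((r - x \<bullet> x) + (r - y \<bullet> y)))"
    using mult_strict_left_mono[OF _ rc] by (fastforce simp: mult_ac)
  moreover have "0 < \<mu> * ((r - x \<bullet> x) + (r - y \<bullet> y))"
    using \<mu> lt by simp
  ultimately show False by (simp add: c_def mult_less_cancel_right)
qed

theorem theorem3:
  fixes \<Sigma>\<^sub>1 \<Sigma>\<^sub>2 T :: "'a::euclidean_space set"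
    and \<nu> :: "'a \<Rightarrow> 'a"
    and R :: "'a \<Rightarrow> real"
    and P :: "real poly"
    and b c :: real
    and m :: nat
  assumes "self_shrinker m \<Sigma>\<^sub>1" and "properly_embedded \<Sigma>\<^sub>1" and "connected \<Sigma>\<^sub>1"
    and "self_shrinker m \<Sigma>\<^sub>2" and "properly_embedded \<Sigma>\<^sub>2" and "connected \<Sigma>\<^sub>2"
    and "0 < b" and "0 < c" and "0 < real m * c + b" and "real m * c + b < 1 / 2"
    and "Liminf (at_infinity_within \<Sigma>\<^sub>2)
           (\<lambda>z. ereal (infdist z \<Sigma>\<^sub>1 / (exp (- b * (norm z)\<^sup>2) * inverse (poly P (norm z))))) > 0"
    and "regular_tubular_neighborhood \<Sigma>\<^sub>2 \<nu> R T"
    and "Liminf (at_infinity_within \<Sigma>\<^sub>2)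
           (\<lambda>z. ereal (R z / (exp (- c * (norm z)\<^sup>2) * inverse (poly P (norm z))))) > 0"
  shows "\<Sigma>\<^sub>1 \<inter> \<Sigma>\<^sub>2 \<noteq> {}"
  using frankel_self_shrinkers assms(1,2,4,5) by blast

end
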